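(* Let $\mathcal H$ be a real Hilbert space, $A,B:\mathcal H\to2^{\mathcal H}$ maximal monotone, $C:\mathcal H\to\mathcal H$ $\beta$-cocoercive with $\beta>0$. Let $\varepsilon\in(0,1)$, $\gamma\in(0,2\beta\varepsilon)$, $\alpha=1/(2-\varepsilon)$, and $$T:=I_{\mathcal H}-J_{\gamma B}+J_{\gamma A}\circ(2J_{\gamma B}-I_{\mathcal H}-\gamma C\circ J_{\gamma B}).$$ Suppose $\mathrm{Fix}\,T\ne\emptyset$. Let $(\lambda_j)_{j\ge0}\subseteq(0,1/\alpha)$ be such that, with $\tau_k:=(1-\alpha\lambda_k)\lambda_k/\alpha$, we have $\sum_{i=0}^\infty\tau_i=\infty$. Let $z^0\in\mathcal H$ and $z^{k+1}=z^k+\lambda_k(Tz^k-z^k)$ for all $k\ge0$. Put $x_B^k:=J_{\gamma B}(z^k)$. Then: 1. For every $z^\ast\in\mathrm{Fix}\,T$, $(\|z^j-z^\ast\|)_{j\ge0}$ is monotonically decreasing (nonincreasing). 2. $(\|Tz^j-z^j\|)_{j\ge0}$ is monotonically decreasing (nonincreasing) and converges to $0$. 3. $(z^j)_{j\ge0}$ converges weakly to a fixed point of $T$. 4. Let $x^\ast\in\mathrm{zer}(A+B+C)$, $z^\ast\in\mathrm{Fix}\,T$ and suppose $\inf_{j\ge0}\lambda_j>0$. Then $$\sum_{i=0}^\infty\lambda_i\|Cx_B^i-Cx^\ast\|^2\le\frac{1}{\gamma(2\beta-\gamma/\varepsilon)}\|z^0-z^\ast\|^2.$$ In particular, $(Cx_B^j)_{j\ge0}$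 converges strongly to $Cx^\ast$. 5. Suppose $\inf_{j\ge0}\lambda_j>0$ and let $z^\ast$ be the weak limit of $(z^j)_{j\ge0}$. Then $(J_{\gamma B}(z^j))_{j\ge0}$ converges weakly to $J_{\gamma B}(z^\ast)\in\mathrm{zer}(A+B+C)$. 6. Suppose $\inf_{j\ge0}\lambda_j>0$ and let $z^\ast$ be the weak limit of $(z^j)_{j\ge0}$. Then $(J_{\gamma A}\circ(2J_{\gamma B}-I_{\mathcal H}-\gamma C\circ J_{\gamma B})(z^j))_{j\ge0}$ converges weakly to $J_{\gamma B}(z^\ast)\in\mathrm{zer}(A+B+C)$. 7. Suppose $\underline\tau:=\inf_{j\ge0}\tau_j>0$. Then for every $z^\ast\in\mathrm{Fix}\,T$ and all $k\ge0$, $\|Tz^k-z^k\|^2\le\frac{\|z^0-z^\ast\|^2}{\underline\tau(k+1)}$, and $\|Tz^k-z^k\|^2=o\left(\frac1{k+1}\right)$. 8. The sequences $(J_{\gamma B}(z^j))_{j\ge0}$ and $(J_{\gamma A}\circ(2J_{\gamma B}-I_{\mathcal H}-\gamma C\circ J_{\gamma B})(z^j))_{j\ge0}$ converge strongly to a point of $\mathrm{zer}(A+B+C)$ whenever any of the following holds: (a) $A$ is uniformly monotone on every nonempty bounded subset of $\mathrm{dom}(A)$; (b) $B$ is uniformly monotone on every nonempty bounded subset of $\mathrm{dom}(B)$; (c) $C$ is demiregular at every point $x\in\mathrm{zer}(A+B+C)$.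
   Context: $C$ is $\beta$-cocoercive if $\langle Cx-Cy,x-y\rangle\ge\beta\|Cx-Cy\|^2$ for all $x,y$. $J_S:=(I_{\mathcal H}+S)^{-1}$; $\mathrm{zer}(S)=\{x:0\in Sx\}$; $\mathrm{Fix}\,T$ is the fixed-point set. A monotone operator $A$ is uniformly monotone on a set $S\subseteq\mathrm{dom}(A)$ if there is an increasing function $\phi:\mathbb R_+\to[0,+\infty]$ vanishing only at $0$ such that $\langle x-y,u-v\rangle\ge\phi(\|x-y\|)$ for all $x,y\in S$, $u\in Ax$, $v\in Ay$. The map $C$ is demiregular at $x$ if for every sequence $(x^k)$ with $x^k\rightharpoonup x$ (weakly) and $Cx^k\to Cx$ (strongly) we have $x^k\to x$ strongly. *)

theory Defs
  imports "HOL-Analysis.Analysis" "HOL-Library.Landau_Symbols"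
begin

text \<open>Set-valued operators on a space \<open>'a\<close> are functions \<open>'a \<Rightarrow> 'a set\<close>.\<close>

definition graph_op :: "('a \<Rightarrow> 'a set) \<Rightarrow> ('a \<times> 'a) set"
  where "graph_op A = {(x, u). u \<in> A x}"

definition dom_op :: "('a \<Rightarrow> 'a set) \<Rightarrow> 'a set"
  where "dom_op A = {x. A x \<noteq> {}}"

definition zer :: "('a::zero \<Rightarrow> 'a set) \<Rightarrow> 'a set"
  where "zer A = {x. 0 \<in> A x}"

definition Fix :: "('a \<Rightarrow> 'a) \<Rightarrow> 'a set"
  where "Fix T = {x. T x = x}"

definition scale_op :: "real \<Rightarrow> ('a::real_vector \<Rightarrow> 'a set) \<Rightarrow> 'a \<Rightarrow> 'a set"
  where "scale_op c A x = scaleR c ` A x"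

definition plus_op :: "('a::plus \<Rightarrow> 'a set) \<Rightarrow> ('a \<Rightarrow> 'a set) \<Rightarrow> 'a \<Rightarrow> 'a set"
  where "plus_op A B x = {u + v | u v. u \<in> A x \<and> v \<in> B x}"

definition single_op :: "('a \<Rightarrow> 'a) \<Rightarrow> 'a \<Rightarrow> 'a set"
  where "single_op C x = {C x}"

definition inverse_op :: "('a \<Rightarrow> 'a set) \<Rightarrow> 'a \<Rightarrow> 'a set"
  where "inverse_op A u = {x. u \<in> A x}"

definition monotone_op :: "('a::real_inner \<Rightarrow> 'a set) \<Rightarrow> bool"
  where "monotone_op A \<longleftrightarrow>
    (\<forall>x y. \<forall>u\<in>A x. \<forall>v\<in>A y. (x - y) \<bullet> (u - v) \<ge> 0)"

definition maximal_monotone_op :: "('a::real_inner \<Rightarrow> 'a set) \<Rightarrow> bool"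
  where "maximal_monotone_op A \<longleftrightarrow> monotone_op A \<and>
    (\<forall>A'. monotone_op A' \<and> graph_op A \<subseteq> graph_op A' \<longrightarrow> graph_op A' = graph_op A)"

text \<open>The set-valued operator \<open>(I + S)\<inverse>\<close>, read as a function. By Minty's theorem its values are
  singletons when \<open>S\<close> is maximal monotone (on a Hilbert space); where a value is not a singleton,
  \<^const>\<open>the_elem\<close> is unspecified.\<close>

definition resolvent :: "('a::real_vector \<Rightarrow> 'a set) \<Rightarrow> 'a \<Rightarrow> 'a"
  where "resolvent S z = the_elem (inverse_op (plus_op (single_op id) S) z)"

definition cocoercive :: "real \<Rightarrow> ('a::real_inner \<Rightarrow> 'a) \<Rightarrow> bool"
  where "cocoercive \<beta> C \<longleftrightarrow>
    (\<forall>x y. (C x - C y) \<bullet> (x - y) \<ge> \<beta> * (norm (C x - C y))\<^sup>2)"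

text \<open>The modulus maps \<open>[0,\<infinity>)\<close> to \<open>[0,\<infinity>]\<close>; ``increasing'' is taken in the non-strict sense, and
  only its values on \<open>[0,\<infinity>)\<close> matter.\<close>

definition uniformly_monotone_on :: "'a set \<Rightarrow> ('a::real_inner \<Rightarrow> 'a set) \<Rightarrow> bool"
  where "uniformly_monotone_on S A \<longleftrightarrow> S \<subseteq> dom_op A \<and>
    (\<exists>\<phi> :: real \<Rightarrow> ereal.
      mono_on {0..} \<phi> \<and> (\<forall>t\<ge>0. \<phi> t \<ge> 0 \<and> (\<phi> t = 0 \<longleftrightarrow> t = 0)) \<and>
      (\<forall>x\<in>S. \<forall>y\<in>S. \<forall>u\<in>A x. \<forall>v\<in>A y.
        ereal ((x - y) \<bullet> (u - v)) \<ge> \<phi> (norm (x - y))))"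

definition weakly_converges :: "(nat \<Rightarrow> 'a::real_inner) \<Rightarrow> 'a \<Rightarrow> bool"
  where "weakly_converges x l \<longleftrightarrow> (\<forall>y. (\<lambda>k. x k \<bullet> y) \<longlonglongrightarrow> l \<bullet> y)"

definition demiregular_at :: "('a::real_inner \<Rightarrow> 'a) \<Rightarrow> 'a \<Rightarrow> bool"
  where "demiregular_at C x \<longleftrightarrow>
    (\<forall>xs. weakly_converges xs x \<and> (\<lambda>k. C (xs k)) \<longlonglongrightarrow> C x \<longrightarrow> xs \<longlonglongrightarrow> x)"

end

theory Submission
  imports Defs
begin

text \<open>\<open>T\<close> is averaged, and keeping the monotonicity terms of \<open>A\<close> and \<open>B\<close> in the proof of this gives
  \<open>\<parallel>T w - T v\<parallel>\<^sup>2 + (1 - \<epsilon>) \<parallel>(T w - w) - (T v - v)\<parallel>\<^sup>2 + g w v \<le> \<parallel>w - v\<parallel>\<^sup>2\<close>, where \<open>g w v \<ge> 0\<close> dominates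
  \<open>\<gamma> (2 \<beta> - \<gamma> / \<epsilon>) \<parallel>C (JB w) - C (JB v)\<parallel>\<^sup>2\<close> and the two monotonicity products. Summation along the
  relaxed iteration yields Fejer monotonicity and \<open>\<parallel>T (z k) - z k\<parallel> \<longlonglongrightarrow> 0\<close>, and the latter alone, with
  \<open>v\<close> a fixed point of \<open>T\<close>, forces \<open>g (z k) v \<longlonglongrightarrow> 0\<close>. Hence \<open>C (JB (z k))\<close> converges strongly and
  uniform monotonicity or demiregularity upgrades weak to strong convergence. Weak sequential
  compactness is avoided: weak limits are found as asymptotic centers.\<close>

section \<open>Minimizers of strongly convex functions given by their epigraphs\<close>

lemma norm_sq_midpoint:
  fixes x y :: "'a::real_inner"
  shows "(norm ((1/2) *\<^sub>R (x + y)))\<^sup>2 = ((norm x)\<^sup>2 + (norm y)\<^sup>2) / 2 - (norm (x - y))\<^sup>2 / 4"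
  unfolding power2_norm_eq_inner
  by (simp add: inner_simps inner_commute field_simps)

text \<open>\<open>P x r\<close> plays the role of f x \<le> r, so that f may take the value
  infinity without special treatment. A minimizing sequence is Cauchy because the value at the
  midpoint of two of its points cannot drop below the infimum.\<close>

lemma strongly_convex_minimizer:
  fixes P :: "'a::{real_normed_vector, complete_space} \<Rightarrow> real \<Rightarrow> bool"
  assumes ex: "P x\<^sub>0 r\<^sub>0"
    and lower: "\<And>x r. P x r \<Longrightarrow> l \<le> r"
    and midpoint: "\<And>x y r s. P x r \<Longrightarrow> P y s
      \<Longrightarrow> P ((1/2) *\<^sub>R (x + y)) ((r + s) / 2 - c * (norm (x - y))\<^sup>2)"
    and c: "c > 0"
    and closed: "\<And>X R x r. (\<And>n. P (X n) (R n)) \<Longrightarrow> X \<longlonglongrightarrow> x \<Longrightarrow> R \<longlonglongrightarrow> r \<Longrightarrow> P x r"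
  obtains x m where "P x m" "\<And>y r. P y r \<Longrightarrow> m \<le> r"
proof -
  define m where "m = Inf {r. \<exists>x. P x r}"
  have bdd: "bdd_below {r. \<exists>x. P x r}" using lower by (auto intro!: bdd_belowI[of _ l])
  have m_le: "m \<le> r" if "P y r" for y r
    unfolding m_def using that bdd by (auto intro!: cInf_lower)
  have "\<exists>x r. P x r \<and> r < m + e" if "e > 0" for e
  proof -
    have "Inf {r. \<exists>x. P x r} < m + e" using that by (simp add: m_def)
    moreover have "{r. \<exists>x. P x r} \<noteq> {}" using ex by auto
    ultimately show ?thesis by (subst (asm) cInf_less_iff[OF _ bdd]) auto
  qed
  then have "\<forall>n. \<exists>x r. P x r \<and> r < m + inverse (real (Suc n))" by simp
  then obtain X R where X: "\<And>n. P (X n) (R n)" and R: "\<And>n. R n < m + inverse (real (Suc n))"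
    by metis
  have "R \<longlonglongrightarrow> m"
  proof (rule tendsto_sandwich)
    show "eventually (\<lambda>n. m \<le> R n) sequentially" using m_le[OF X] by simp
    show "eventually (\<lambda>n. R n \<le> m + inverse (real (Suc n))) sequentially"
      using less_imp_le[OF R] by (rule always_eventually[OF allI])
    show "(\<lambda>n. m + inverse (real (Suc n))) \<longlonglongrightarrow> m"
      using tendsto_add[OF tendsto_const LIMSEQ_inverse_real_of_nat, of m] by simp
  qed auto
  have dist_le: "c * (norm (X i - X j))\<^sup>2 \<le> (R i + R j) / 2 - m" for i j
    using m_le[OF midpoint[OF X X]] by (simp add: algebra_simps)
  have "Cauchy X"
  proof (rule metric_CauchyI)
    fix e :: real assume "e > 0"
    then have "c * e\<^sup>2 > 0" using c by simp
    then have "eventually (\<lambda>n. R n < m + c * e\<^sup>2) sequentially"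
      using \<open>R \<longlonglongrightarrow> m\<close> by (intro order_tendstoD(2)) auto
    then obtain N where N: "\<And>n. n \<ge> N \<Longrightarrow> R n < m + c * e\<^sup>2" by (auto simp: eventually_sequentially)
    have "dist (X i) (X j) < e" if "i \<ge> N" "j \<ge> N" for i j
    proof -
      have "c * (norm (X i - X j))\<^sup>2 < c * e\<^sup>2"
        using dist_le[of i j] N[OF that(1)] N[OF that(2)] by (simp add: field_simps)
      then have "(norm (X i - X j))\<^sup>2 < e\<^sup>2" using c by simp
      then show ?thesis using \<open>e > 0\<close> by (simp add: dist_norm power2_less_imp_less)
    qed
    then show "\<exists>M. \<forall>i\<ge>M. \<forall>j\<ge>M. dist (X i) (X j) < e" by blast
  qed
  then obtain x where "X \<longlonglongrightarrow> x" using Cauchy_convergent_iff convergent_def by blast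
  then have "P x m" using closed[OF X _ \<open>R \<longlonglongrightarrow> m\<close>] by blast
  then show ?thesis using that m_le by blast
qed

section \<open>Minty's theorem\<close>

lemma monotone_opD:
  "monotone_op A \<Longrightarrow> u \<in> A x \<Longrightarrow> v \<in> A y \<Longrightarrow> (x - y) \<bullet> (u - v) \<ge> 0"
  by (auto simp: monotone_op_def)

lemma maximal_monotone_op_imp_monotone: "maximal_monotone_op A \<Longrightarrow> monotone_op A"
  by (simp add: maximal_monotone_op_def)

text \<open>Adding the pair (x, u) to the graph keeps it monotone, so by maximality the pair was
  there already.\<close>

lemma maximal_monotone_op_memI:
  assumes "maximal_monotone_op A" and rel: "\<And>a b. b \<in> A a \<Longrightarrow> (x - a) \<bullet> (u - b) \<ge> 0"
  shows "u \<in> A x"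
proof -
  define A' where "A' = A(x := insert u (A x))"
  have "monotone_op A'"
    unfolding monotone_op_def
  proof (intro allI ballI)
    fix a a' b b' assume "b \<in> A' a" "b' \<in> A' a'"
    moreover have "(a - x) \<bullet> (b - u) \<ge> 0" if "b \<in> A a" for a b
      using rel[OF that] by (simp add: inner_simps)
    ultimately show "(a - a') \<bullet> (b - b') \<ge> 0"
      using rel monotone_opD[OF maximal_monotone_op_imp_monotone[OF assms(1)]]
      by (auto simp: A'_def split: if_splits)
  qed
  moreover have "graph_op A \<subseteq> graph_op A'" by (auto simp: graph_op_def A'_def)
  ultimately have "graph_op A' = graph_op A"
    using assms(1) unfolding maximal_monotone_op_def by blast
  moreover have "(x, u) \<in> graph_op A'" by (simp add: graph_op_def A'_def)
  ultimately show ?thesis by (simp add: graph_op_def)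
qed

text \<open>For an empty graph the premise of the membership criterion is vacuous, which would put 0
  into \<open>A 0\<close>.\<close>

lemma maximal_monotone_op_nonempty:
  fixes A :: "'a::real_inner \<Rightarrow> 'a set"
  assumes "maximal_monotone_op A"
  obtains a b where "b \<in> A a"
  using maximal_monotone_op_memI[OF assms, of 0 0] by blast

text \<open>Minimize \<open>F + \<parallel>\<cdot>\<parallel>\<^sup>2/2\<close> on the product space, where \<open>F\<close> is the Fitzpatrick function of \<open>A\<close>; since
  \<open>F\<close> may be infinite, the minimization is over its epigraph. Maximality gives \<open>F (x, u) \<ge> x \<bullet> u\<close>,
  with equality on the graph, and optimality of \<open>(x, u)\<close> then puts \<open>(-u, -x)\<close> in the graph and
  forces \<open>u = -x\<close>.\<close>

lemma maximal_monotone_op_minus_mem: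
  fixes A :: "'a::{real_inner, complete_space} \<Rightarrow> 'a set"
  assumes A: "maximal_monotone_op A"
  obtains x where "- x \<in> A x"
proof -
  \<comment> \<open>\<open>F (x, u) t\<close> bounds by \<open>t\<close> the supremum over the graph
    that defines the Fitzpatrick function; \<open>P\<close> is the epigraph after half the squared
    norm is added.\<close>
  define F where "F = (\<lambda>(x, u) t. \<forall>a b. b \<in> A a \<longrightarrow> x \<bullet> b + a \<bullet> u - a \<bullet> b \<le> t)"
  define P where "P = (\<lambda>p r. F p (r - (norm p)\<^sup>2 / 2))" for p r
  note mono = monotone_opD[OF maximal_monotone_op_imp_monotone[OF A]]
  have norm_pair: "(norm (x, u))\<^sup>2 = (norm x)\<^sup>2 + (norm u)\<^sup>2" for x u :: 'a
    by (simp add: norm_Pair)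
  \<comment> \<open>Otherwise (x, u) is strictly monotonically related to the whole graph, hence
    belongs to it, and testing the pair against itself gives 0 > 0.\<close>
  have F_ge: "x \<bullet> u \<le> t" if "F (x, u) t" for x u t
  proof (rule ccontr)
    assume "\<not> x \<bullet> u \<le> t"
    then have *: "(x - a) \<bullet> (u - b) > 0" if "b \<in> A a" for a b
      using \<open>F (x, u) t\<close> that by (fastforce simp: F_def inner_simps)
    then have "u \<in> A x" by (intro maximal_monotone_op_memI[OF A]) (auto intro: less_imp_le)
    then show False using *[of u x] by simp
  qed
  have F_graph: "F (a, b) (a \<bullet> b)" if "b \<in> A a" for a b
    using mono[OF that] by (fastforce simp: F_def inner_simps)
  have F_convex: "F ((1 - s) *\<^sub>R p + s *\<^sub>R q) ((1 - s) * r + s * t)"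
    if "F p r" "F q t" "0 \<le> s" "s \<le> 1" for p q r s t
  proof -
    obtain x u y v where pq: "p = (x, u)" "q = (y, v)" by fastforce
    show ?thesis unfolding pq F_def
    proof (clarsimp)
      fix a b assume ab: "b \<in> A a"
      have "(1 - s) * (x \<bullet> b + a \<bullet> u - a \<bullet> b) + s * (y \<bullet> b + a \<bullet> v - a \<bullet> b) \<le> (1 - s) * r + s * t"
        using that ab by (intro add_mono mult_left_mono) (auto simp: F_def pq)
      then show "((1 - s) *\<^sub>R x + s *\<^sub>R y) \<bullet> b + a \<bullet> ((1 - s) *\<^sub>R u + s *\<^sub>R v) - a \<bullet> b \<le> (1 - s) * r + s * t"
        by (simp add: inner_simps algebra_simps)
    qed
  qed
  obtain a\<^sub>0 b\<^sub>0 where ab0: "b\<^sub>0 \<in> A a\<^sub>0" using maximal_monotone_op_nonempty[OF A] .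
  obtain p m where p: "P p m" and min: "\<And>q r. P q r \<Longrightarrow> m \<le> r"
  proof (rule strongly_convex_minimizer[of P "(a\<^sub>0, b\<^sub>0)" "a\<^sub>0 \<bullet> b\<^sub>0 + (norm (a\<^sub>0, b\<^sub>0))\<^sup>2 / 2" 0 "1 / 8"])
    show "P (a\<^sub>0, b\<^sub>0) (a\<^sub>0 \<bullet> b\<^sub>0 + (norm (a\<^sub>0, b\<^sub>0))\<^sup>2 / 2)"
      using F_graph[OF ab0] by (simp add: P_def)
    \<comment> \<open>Adding half the squared norm of (x, u) to \<open>x \<bullet> u\<close>
      completes the square \<open>(norm (x + u))\<^sup>2 / 2\<close>.\<close>
    show "0 \<le> r" if "P q r" for q r
    proof -
      obtain x u where q: "q = (x, u)" by fastforce
      have "x \<bullet> u \<le> r - (norm q)\<^sup>2 / 2" using that F_ge unfolding P_def q by blast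
      then have "(norm (x + u))\<^sup>2 / 2 \<le> r"
        unfolding q norm_pair by (simp add: power2_norm_eq_inner inner_simps inner_commute field_simps)
      then show ?thesis using zero_le_power2[of "norm (x + u)"] by linarith
    qed
    \<comment> \<open>The constant 1/8 is half of the 1/4 in the parallelogram identity;
      \<open>F\<close> contributes plain convexity.\<close>
    show "P ((1/2) *\<^sub>R (q + q')) ((r + s) / 2 - 1 / 8 * (norm (q - q'))\<^sup>2)"
      if "P q r" "P q' s" for q q' r s
    proof -
      have "F ((1 - 1/2) *\<^sub>R q + (1/2) *\<^sub>R q')
          ((1 - 1/2) * (r - (norm q)\<^sup>2 / 2) + 1/2 * (s - (norm q')\<^sup>2 / 2))"
        using that by (intro F_convex) (auto simp: P_def)
      moreover have "(1 - 1/2) *\<^sub>R q + (1/2) *\<^sub>R q' = (1/2) *\<^sub>R (q + q')"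
        by (simp add: scaleR_add_right)
      moreover have "(1 - 1/2) * (r - (norm q)\<^sup>2 / 2) + 1/2 * (s - (norm q')\<^sup>2 / 2)
          = (r + s) / 2 - 1 / 8 * (norm (q - q'))\<^sup>2 - (norm ((1/2) *\<^sub>R (q + q')))\<^sup>2 / 2"
        unfolding norm_sq_midpoint by (simp add: field_simps)
      ultimately show ?thesis unfolding P_def by metis
    qed
    show "P q r" if PX: "\<And>n. P (X n) (R n)" and lim: "X \<longlonglongrightarrow> q" "R \<longlonglongrightarrow> r" for X R q r
    proof -
      obtain x u where q: "q = (x, u)" by fastforce
      have "x \<bullet> b + a \<bullet> u - a \<bullet> b \<le> r - (norm q)\<^sup>2 / 2" if "b \<in> A a" for a b
      proof (rule LIMSEQ_le)
        show "(\<lambda>n. fst (X n) \<bullet> b + a \<bullet> snd (X n) - a \<bullet> b) \<longlonglongrightarrow> x \<bullet> b + a \<bullet> u - a \<bullet> b"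
          using tendsto_fst[OF lim(1)] tendsto_snd[OF lim(1)] unfolding q
          by (auto intro!: tendsto_intros)
        show "(\<lambda>n. R n - (norm (X n))\<^sup>2 / 2) \<longlonglongrightarrow> r - (norm q)\<^sup>2 / 2"
          using lim by (auto intro!: tendsto_intros)
        show "\<exists>N. \<forall>n\<ge>N. fst (X n) \<bullet> b + a \<bullet> snd (X n) - a \<bullet> b \<le> R n - (norm (X n))\<^sup>2 / 2"
          using PX that by (auto simp: P_def F_def case_prod_beta)
      qed
      then show ?thesis by (simp add: P_def F_def q)
    qed
  qed auto
  obtain x u where pxu: "p = (x, u)" by fastforce
  define t where "t = m - (norm p)\<^sup>2 / 2"
  have "F p t" using p by (simp add: P_def t_def)
  then have t: "x \<bullet> u \<le> t" using F_ge pxu by blast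
  \<comment> \<open>First-order condition at the minimizer: move from \<open>p\<close> towards
    \<open>q\<close> by \<open>s\<close>, divide the change by \<open>s\<close> and let
    \<open>s\<close> tend to 0 from the right.\<close>
  have optimal: "t + p \<bullet> (p - q) \<le> r" if "F q r" for q r
  proof -
    have "(t + p \<bullet> (p - q) - r) \<le> s * ((norm (q - p))\<^sup>2 / 2)" if s: "0 < s" "s < 1" for s
    proof -
      define w where "w = (1 - s) *\<^sub>R p + s *\<^sub>R q"
      have "F w ((1 - s) * t + s * r)"
        unfolding w_def using F_convex[OF \<open>F p t\<close> \<open>F q r\<close>] s by simp
      then have "P w ((1 - s) * t + s * r + (norm w)\<^sup>2 / 2)" by (simp add: P_def)
      from min[OF this] have "t + (norm p)\<^sup>2 / 2 \<le> (1 - s) * t + s * r + (norm w)\<^sup>2 / 2"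
        by (simp add: t_def)
      moreover have "(norm w)\<^sup>2 = (norm p)\<^sup>2 + 2 * s * (p \<bullet> (q - p)) + s\<^sup>2 * (norm (q - p))\<^sup>2"
      proof -
        have w: "w = p + s *\<^sub>R (q - p)" by (simp add: w_def algebra_simps)
        show ?thesis unfolding w power2_norm_eq_inner by (simp add: inner_simps inner_commute algebra_simps power2_eq_square)
      qed
      ultimately have "s * (t + p \<bullet> (p - q) - r) \<le> s * (s * ((norm (q - p))\<^sup>2 / 2))"
        by (simp add: inner_simps power2_eq_square field_simps)
      then show ?thesis using s by simp
    qed
    then have "eventually (\<lambda>s. t + p \<bullet> (p - q) - r \<le> s * ((norm (q - p))\<^sup>2 / 2)) (at_right 0)"
      unfolding eventually_at_right_field by (intro exI[of _ 1]) auto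
    moreover have "((\<lambda>s. s * ((norm (q - p))\<^sup>2 / 2)) \<longlongrightarrow> 0 * ((norm (q - p))\<^sup>2 / 2)) (at_right 0)"
      by (intro tendsto_intros)
    ultimately have "t + p \<bullet> (p - q) - r \<le> 0 * ((norm (q - p))\<^sup>2 / 2)"
      by (intro tendsto_lowerbound) auto
    then show ?thesis by simp
  qed
  \<comment> \<open>Optimality is tested on q = (a, b), where \<open>F\<close> is at most
    \<open>a \<bullet> b\<close>; with \<open>x \<bullet> u\<close> bounding \<open>t\<close> from
    below, adding \<open>x \<bullet> u\<close> on both sides completes the squares.\<close>
  have key: "(a + u) \<bullet> (b + x) \<ge> (norm (x + u))\<^sup>2" if "b \<in> A a" for a b
    using optimal[OF F_graph[OF that]] t unfolding pxu
    by (simp add: power2_norm_eq_inner inner_simps inner_commute)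
  have "- x \<in> A (- u)"
  proof (rule maximal_monotone_op_memI[OF A])
    fix a b assume "b \<in> A a"
    have "(- u - a) \<bullet> (- x - b) = (a + u) \<bullet> (b + x)" by (simp add: inner_simps)
    then show "0 \<le> (- u - a) \<bullet> (- x - b)"
      using key[OF \<open>b \<in> A a\<close>] zero_le_power2[of "norm (x + u)"] by linarith
  qed
  \<comment> \<open>At the pair (-u, -x) the left side of \<open>key\<close> is 0.\<close>
  from key[OF this] have "x + u = 0" by simp
  then have "- u = x" by (simp add: eq_neg_iff_add_eq_0 add.commute neg_eq_iff_add_eq_0)
  then show ?thesis using that \<open>- x \<in> A (- u)\<close> by simp
qed

text \<open>Reduces surjectivity of I + A at \<open>w\<close> to the case w = 0.\<close>

lemma maximal_monotone_op_translate:
  assumes "maximal_monotone_op A"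
  shows "maximal_monotone_op (\<lambda>x. (\<lambda>u. u - w) ` A x)"
  unfolding maximal_monotone_op_def
proof (intro conjI allI impI)
  show "monotone_op (\<lambda>x. (\<lambda>u. u - w) ` A x)"
    using monotone_opD[OF maximal_monotone_op_imp_monotone[OF assms]]
    by (auto simp: monotone_op_def)
  fix A' assume A': "monotone_op A' \<and> graph_op (\<lambda>x. (\<lambda>u. u - w) ` A x) \<subseteq> graph_op A'"
  have "u \<in> (\<lambda>u. u - w) ` A x" if "u \<in> A' x" for x u
  proof -
    have "u + w \<in> A x"
    proof (rule maximal_monotone_op_memI[OF assms])
      fix a b assume "b \<in> A a"
      then have "b - w \<in> A' a" using A' by (auto simp: graph_op_def)
      then show "0 \<le> (x - a) \<bullet> (u + w - b)"
        using monotone_opD[of A' u x "b - w" a] A' that by (simp add: algebra_simps)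
    qed
    then show ?thesis by (force intro: image_eqI[of _ _ "u + w"])
  qed
  then show "graph_op A' = graph_op (\<lambda>x. (\<lambda>u. u - w) ` A x)"
    using A' by (auto simp: graph_op_def)
qed

lemma maximal_monotone_op_scale:
  assumes "maximal_monotone_op A" "c > 0"
  shows "maximal_monotone_op (scale_op c A)"
  unfolding maximal_monotone_op_def
proof (intro conjI allI impI)
  note mono = monotone_opD[OF maximal_monotone_op_imp_monotone[OF assms(1)]]
  show "monotone_op (scale_op c A)"
    using mono assms(2)
    by (auto simp: monotone_op_def scale_op_def simp flip: scaleR_diff_right)
  fix A' assume A': "monotone_op A' \<and> graph_op (scale_op c A) \<subseteq> graph_op A'"
  have "u \<in> scale_op c A x" if "u \<in> A' x" for x u
  proof -
    have "u /\<^sub>R c \<in> A x"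
    proof (rule maximal_monotone_op_memI[OF assms(1)])
      fix a b assume "b \<in> A a"
      then have "c *\<^sub>R b \<in> A' a" using A' by (auto simp: graph_op_def scale_op_def)
      then have "0 \<le> (x - a) \<bullet> (u - c *\<^sub>R b) / c"
        using monotone_opD[of A' u x "c *\<^sub>R b" a] A' that assms(2) by simp
      also have "\<dots> = (x - a) \<bullet> (u /\<^sub>R c - b)" using assms(2)
        by (simp add: inner_simps field_simps)
      finally show "0 \<le> (x - a) \<bullet> (u /\<^sub>R c - b)" .
    qed
    then show ?thesis using assms(2) by (force simp: scale_op_def intro: image_eqI[of _ _ "u /\<^sub>R c"])
  qed
  then show "graph_op A' = graph_op (scale_op c A)"
    using A' by (auto simp: graph_op_def)
qed

lemma minty:
  fixes A :: "'a::{real_inner, complete_space} \<Rightarrow> 'a set"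
  assumes "maximal_monotone_op A"
  obtains x where "w - x \<in> A x"
proof -
  obtain x where "- x \<in> (\<lambda>u. u - w) ` A x"
    using maximal_monotone_op_minus_mem[OF maximal_monotone_op_translate[OF assms]] .
  then have "w - x \<in> A x" by (auto simp: algebra_simps)
  then show ?thesis using that by blast
qed

text \<open>For a second solution \<open>y\<close>, monotonicity gives
  \<open>- (y - x) \<bullet> (y - x) \<ge> 0\<close>, so \<open>the_elem\<close> is applied to a
  singleton.\<close>

lemma resolvent_eqI:
  assumes "monotone_op A" "w - x \<in> A x"
  shows "resolvent A w = x"
proof -
  have "inverse_op (plus_op (single_op id) A) w = {x}"
  proof (intro equalityI subsetI)
    fix y assume "y \<in> inverse_op (plus_op (single_op id) A) w"
    then have "w - y \<in> A y" by (auto simp: inverse_op_def plus_op_def single_op_def)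
    from monotone_opD[OF assms(1) this assms(2)] have "(y - x) \<bullet> (y - x) \<le> 0"
      by (simp add: inner_simps inner_commute)
    then show "y \<in> {x}" using inner_ge_zero[of "y - x"] by simp
  next
    fix y assume "y \<in> {x}"
    then show "y \<in> inverse_op (plus_op (single_op id) A) w"
      using assms(2) by (force simp: inverse_op_def plus_op_def single_op_def)
  qed
  then show ?thesis by (simp add: resolvent_def)
qed

lemma resolvent_mem:
  fixes A :: "'a::{real_inner, complete_space} \<Rightarrow> 'a set"
  assumes "maximal_monotone_op A"
  shows "w - resolvent A w \<in> A (resolvent A w)"
proof -
  obtain x where "w - x \<in> A x" using minty[OF assms] .
  then show ?thesis using resolvent_eqI[OF maximal_monotone_op_imp_monotone[OF assms]] by metis
qed

section \<open>Weak convergence of Fejer monotone sequences\<close>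

text \<open>The bound is one-sided, but it is available for both \<open>y\<close> and
  \<open>- y\<close>.\<close>

lemma weakly_converges_if_eventually_less:
  assumes "\<And>y e. e > 0 \<Longrightarrow> eventually (\<lambda>k. (x k - l) \<bullet> y < e) sequentially"
  shows "weakly_converges x l"
  unfolding weakly_converges_def
proof (intro allI tendstoI)
  fix y and e :: real assume "e > 0"
  from assms[OF this, of y] assms[OF this, of "- y"]
  show "eventually (\<lambda>k. dist (x k \<bullet> y) (l \<bullet> y) < e) sequentially"
    by eventually_elim (simp add: dist_real_def inner_simps abs_less_iff)
qed

lemma weakly_converges_unique:
  assumes "weakly_converges x l" "weakly_converges x l'"
  shows "l = l'"
proof -
  have "l \<bullet> (l - l') = l' \<bullet> (l - l')"
    using assms unfolding weakly_converges_def by (blast intro: LIMSEQ_unique)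
  then have "(l - l') \<bullet> (l - l') = 0" by (simp add: inner_diff_left)
  then show ?thesis by simp
qed

lemma weakly_converges_diff_null:
  fixes x y :: "nat \<Rightarrow> 'a::real_inner"
  assumes "weakly_converges x l" "(\<lambda>k. y k - x k) \<longlonglongrightarrow> 0"
  shows "weakly_converges y l"
  unfolding weakly_converges_def
proof
  fix w
  have "(\<lambda>k. x k \<bullet> w + (y k - x k) \<bullet> w) \<longlonglongrightarrow> l \<bullet> w + 0 \<bullet> w"
    using assms(1) unfolding weakly_converges_def
    by (intro tendsto_add tendsto_inner[OF assms(2) tendsto_const]) auto
  then show "(\<lambda>k. y k \<bullet> w) \<longlonglongrightarrow> l \<bullet> w" by (simp add: inner_simps)
qed

text \<open>The epigraph of the squared asymptotic radius, the limit superior of squared distances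
  to \<open>c\<close>, in the relational form that \<open>strongly_convex_minimizer\<close> takes. A
  general filter covers sequences and subsequences alike.\<close>

definition asymptotic_bound :: "'i filter \<Rightarrow> ('i \<Rightarrow> 'a::real_normed_vector) \<Rightarrow> 'a \<Rightarrow> real \<Rightarrow> bool"
  where "asymptotic_bound F x c r \<longleftrightarrow> (\<forall>e>0. eventually (\<lambda>i. (norm (x i - c))\<^sup>2 < r + e) F)"

text \<open>The parallelogram identity for \<open>x i - c\<close> and \<open>x i - d\<close> holds
  at every index, so strong convexity passes to the asymptotic radius.\<close>

lemma asymptotic_bound_midpoint:
  fixes x :: "'i \<Rightarrow> 'a::real_inner"
  assumes "asymptotic_bound F x c r" "asymptotic_bound F x d s"
  shows "asymptotic_bound F x ((1/2) *\<^sub>R (c + d)) ((r + s) / 2 - 1 / 4 * (norm (c - d))\<^sup>2)"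
  unfolding asymptotic_bound_def
proof (intro allI impI)
  fix e :: real assume "e > 0"
  with assms have "eventually (\<lambda>i. (norm (x i - c))\<^sup>2 < r + e) F" "eventually (\<lambda>i. (norm (x i - d))\<^sup>2 < s + e) F"
    by (auto simp: asymptotic_bound_def)
  then show "eventually (\<lambda>i. (norm (x i - (1/2) *\<^sub>R (c + d)))\<^sup>2
      < (r + s) / 2 - 1 / 4 * (norm (c - d))\<^sup>2 + e) F"
  proof eventually_elim
    case (elim i)
    have "x i - (1/2) *\<^sub>R (c + d) = (1/2) *\<^sub>R ((x i - c) + (x i - d))"
      by (simp add: algebra_simps flip: scaleR_add_left)
    then have "(norm (x i - (1/2) *\<^sub>R (c + d)))\<^sup>2
        = ((norm (x i - c))\<^sup>2 + (norm (x i - d))\<^sup>2) / 2 - (norm (c - d))\<^sup>2 / 4"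
      using norm_sq_midpoint[of "x i - c" "x i - d"] by (simp add: norm_minus_commute)
    moreover have "a / 2 + b / 2 - n / 4 < (r + s) / 2 - 1 / 4 * n + e" if "a < r + e" "b < s + e" for a b n :: real
      using that by (simp add: field_simps)
    ultimately show ?case using elim by (simp add: add_divide_distrib)
  qed
qed

lemma asymptotic_bound_nonneg:
  assumes "asymptotic_bound F x c r" "F \<noteq> bot"
  shows "0 \<le> r"
proof (rule ccontr)
  assume "\<not> 0 \<le> r"
  then have "eventually (\<lambda>i. (norm (x i - c))\<^sup>2 < r + - r) F"
    using assms(1) by (simp only: asymptotic_bound_def)
  then show False using assms(2) by (simp add: trivial_limit_def not_less)
qed

lemma asymptotic_center_exists:
  fixes x :: "'i \<Rightarrow> 'a::{real_inner, complete_space}"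
  assumes "F \<noteq> bot" "asymptotic_bound F x c\<^sub>0 r\<^sub>0"
  obtains c m where "asymptotic_bound F x c m" "\<And>d r. asymptotic_bound F x d r \<Longrightarrow> m \<le> r"
proof (rule strongly_convex_minimizer[of "asymptotic_bound F x" c\<^sub>0 r\<^sub>0 0 "1/4"])
  show "asymptotic_bound F x c r"
    if bd: "\<And>n. asymptotic_bound F x (X n) (R n)" and lim: "X \<longlonglongrightarrow> c" "R \<longlonglongrightarrow> r" for X R c r
    unfolding asymptotic_bound_def
  proof (intro allI impI)
    fix e :: real assume e: "e > 0"
    \<comment> \<open>The square bounds the squared distance from \<open>x i\<close> to
      \<open>c\<close> by a detour through \<open>X n\<close>. Half of \<open>e\<close> is spent on
      the distance to \<open>X n\<close>, the other half on the limit in \<open>n\<close>.\<close>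
    have "(\<lambda>n. (sqrt (R n + e / 2) + norm (X n - c))\<^sup>2) \<longlonglongrightarrow> (sqrt (r + e / 2) + norm (c - c))\<^sup>2"
      using lim by (intro tendsto_intros)
    moreover have "0 \<le> r"
      using LIMSEQ_le_const[OF lim(2)] asymptotic_bound_nonneg[OF bd assms(1)] by blast
    ultimately have "(\<lambda>n. (sqrt (R n + e / 2) + norm (X n - c))\<^sup>2) \<longlonglongrightarrow> r + e / 2"
      using e by simp
    then have "eventually (\<lambda>n. (sqrt (R n + e / 2) + norm (X n - c))\<^sup>2 < r + e) sequentially"
      using e by (intro order_tendstoD(2)) auto
    then obtain n where n: "(sqrt (R n + e / 2) + norm (X n - c))\<^sup>2 < r + e"
      by (auto simp: eventually_sequentially)
    have "eventually (\<lambda>i. (norm (x i - X n))\<^sup>2 < R n + e / 2) F"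
      using bd[of n] e by (auto simp: asymptotic_bound_def)
    then show "eventually (\<lambda>i. (norm (x i - c))\<^sup>2 < r + e) F"
    proof eventually_elim
      case (elim i)
      have "norm (x i - X n) \<le> sqrt (R n + e / 2)"
        using elim by (intro real_le_rsqrt) simp
      moreover have "norm (x i - c) \<le> norm (x i - X n) + norm (X n - c)"
        using norm_triangle_ineq[of "x i - X n" "X n - c"] by simp
      ultimately have "(norm (x i - c))\<^sup>2 \<le> (sqrt (R n + e / 2) + norm (X n - c))\<^sup>2"
        by (intro power_mono) auto
      then show ?case using n by simp
    qed
  qed
qed (use assms asymptotic_bound_midpoint asymptotic_bound_nonneg in auto)

text \<open>Since \<open>x i\<close> and \<open>T (x i)\<close> are asymptotically equal and
  \<open>T\<close> does not increase distances to \<open>c\<close>, the point \<open>T c\<close> is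
  as good a center as \<open>c\<close>. Were they distinct, their midpoint would be strictly
  better.\<close>

lemma asymptotic_center_fixed:
  fixes x :: "'i \<Rightarrow> 'a::real_inner"
  assumes F: "F \<noteq> bot" and c: "asymptotic_bound F x c m"
    and min: "\<And>d r. asymptotic_bound F x d r \<Longrightarrow> m \<le> r"
    and nonexp: "\<And>y. norm (T y - T c) \<le> norm (y - c)"
    and asymp: "((\<lambda>i. norm (T (x i) - x i)) \<longlongrightarrow> 0) F"
  shows "T c = c"
proof -
  have m0: "0 \<le> m" using asymptotic_bound_nonneg[OF c F] .
  have "asymptotic_bound F x (T c) m"
    unfolding asymptotic_bound_def
  proof (intro allI impI)
    fix e :: real assume e: "e > 0"
    \<comment> \<open>A residual below \<open>d\<close> raises a distance of at most
      \<open>sqrt (m + e / 2)\<close> to less than \<open>sqrt (m + e)\<close>.\<close>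
    define d where "d = sqrt (m + e) - sqrt (m + e / 2)"
    have "d > 0" using e m0 by (simp add: d_def)
    then have "eventually (\<lambda>i. norm (T (x i) - x i) < d) F"
      using order_tendstoD(2)[OF asymp] by blast
    moreover have "eventually (\<lambda>i. (norm (x i - c))\<^sup>2 < m + e / 2) F"
      using c e by (auto simp: asymptotic_bound_def)
    ultimately show "eventually (\<lambda>i. (norm (x i - T c))\<^sup>2 < m + e) F"
    proof eventually_elim
      case (elim i)
      have "norm (x i - c) \<le> sqrt (m + e / 2)" using elim by (intro real_le_rsqrt) simp
      moreover have "norm (x i - T c) \<le> norm (T (x i) - x i) + norm (T (x i) - T c)"
        using norm_triangle_ineq4[of "T (x i) - T c" "T (x i) - x i"] by simp
      ultimately have "norm (x i - T c) < sqrt (m + e)"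
        using elim nonexp[of "x i"] by (simp add: d_def)
      then have "(norm (x i - T c))\<^sup>2 < (sqrt (m + e))\<^sup>2" by (intro power_strict_mono) auto
      then show ?case using m0 e by simp
    qed
  qed
  from min[OF asymptotic_bound_midpoint[OF c this]] show ?thesis by simp
qed

text \<open>All subsequences of a Fejer monotone sequence have the same asymptotic center \<open>c\<close>, and a
  subsequence with \<open>(x\<^sub>k - c) \<bullet> y \<ge> \<delta> > 0\<close> would be asymptotically closer to \<open>c + s y\<close> for small
  \<open>s > 0\<close>. Restricted filters stand for subsequences.\<close>

lemma fejer_weakly_converges:
  fixes x :: "nat \<Rightarrow> 'a::{real_inner, complete_space}"
  assumes fejer: "\<And>w. w \<in> Fix T \<Longrightarrow> decseq (\<lambda>k. norm (x k - w))"
    and fix_ne: "Fix T \<noteq> {}"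
    and nonexp: "\<And>y w. norm (T y - T w) \<le> norm (y - w)"
    and asymp: "(\<lambda>k. norm (T (x k) - x k)) \<longlonglongrightarrow> 0"
  obtains c where "c \<in> Fix T" "weakly_converges x c"
proof -
  define d where "d w = (INF k. norm (x k - w))\<^sup>2" for w
  have d_lim: "(\<lambda>k. (norm (x k - w))\<^sup>2) \<longlonglongrightarrow> d w" if "w \<in> Fix T" for w
    unfolding d_def using fejer[OF that]
    by (intro tendsto_power LIMSEQ_decseq_INF) (auto intro: bdd_belowI[of _ 0])
  have bound: "asymptotic_bound F x w (d w)" if "w \<in> Fix T" "F \<le> sequentially" for w F
    unfolding asymptotic_bound_def
  proof (intro allI impI)
    fix e :: real assume "e > 0"
    then have "eventually (\<lambda>k. (norm (x k - w))\<^sup>2 < d w + e) sequentially"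
      by (intro order_tendstoD(2)[OF d_lim[OF that(1)]]) simp
    then show "eventually (\<lambda>k. (norm (x k - w))\<^sup>2 < d w + e) F"
      by (rule filter_leD[OF that(2)])
  qed
  \<comment> \<open>At a fixed point the squared distances converge, so passing to a finer filter
    cannot lower the bound.\<close>
  have bound_le: "d w \<le> r" if "w \<in> Fix T" "F \<le> sequentially" "F \<noteq> bot" "asymptotic_bound F x w r" for w r F
  proof (rule field_le_epsilon)
    fix e :: real assume "e > 0"
    then have "eventually (\<lambda>k. (norm (x k - w))\<^sup>2 < r + e) F"
      using that(4) by (simp add: asymptotic_bound_def)
    then have "eventually (\<lambda>k. (norm (x k - w))\<^sup>2 \<le> r + e) F"
      by (rule eventually_mono) simp
    then show "d w \<le> r + e"
      using tendsto_upperbound[OF tendsto_mono[OF that(2) d_lim[OF that(1)]]] that(3) by blast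
  qed
  have center: "\<exists>c. c \<in> Fix T \<and> asymptotic_bound F x c (d c)
      \<and> (\<forall>w r. asymptotic_bound F x w r \<longrightarrow> d c \<le> r)"
    if F: "F \<le> sequentially" "F \<noteq> bot" for F
  proof -
    obtain w where w: "w \<in> Fix T" using fix_ne by blast
    obtain c m where c: "asymptotic_bound F x c m" and min: "\<And>w r. asymptotic_bound F x w r \<Longrightarrow> m \<le> r"
      using asymptotic_center_exists[OF F(2) bound[OF w F(1)]] by blast
    have fix_c: "c \<in> Fix T"
      using asymptotic_center_fixed[OF F(2) c min nonexp tendsto_mono[OF F(1) asymp]]
      by (simp add: Fix_def)
    have "m = d c" using bound_le[OF fix_c F c] min[OF bound[OF fix_c F(1)]] by (rule antisym[rotated])
    then show ?thesis using fix_c c min by blast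
  qed
  obtain c where c: "c \<in> Fix T" "\<And>w r. asymptotic_bound sequentially x w r \<Longrightarrow> d c \<le> r"
    using center[OF order_refl sequentially_bot] by blast
  have "weakly_converges x c"
  proof (rule weakly_converges_if_eventually_less, rule ccontr)
    fix y and e :: real
    assume e: "e > 0" and "\<not> eventually (\<lambda>k. (x k - c) \<bullet> y < e) sequentially"
    \<comment> \<open>This filter is proper because the inner product is at least \<open>e\<close>
      infinitely often.\<close>
    define F where "F = inf sequentially (principal {k. (x k - c) \<bullet> y \<ge> e})"
    have F: "F \<le> sequentially" "F \<noteq> bot"
      using \<open>\<not> eventually _ _\<close>
      by (auto simp: F_def trivial_limit_def eventually_inf_principal not_le)
    obtain c' where c': "c' \<in> Fix T" "asymptotic_bound F x c' (d c')"
      and min: "\<And>w r. asymptotic_bound F x w r \<Longrightarrow> d c' \<le> r"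
      using center[OF F] by blast
    \<comment> \<open>Each center is a fixed point and so a competitor for the other filter with an
      unchanged bound. The values therefore agree, and the midpoint bound then makes the points
      agree.\<close>
    have "d c' = d c" using min[OF bound[OF c(1) F(1)]] c(2)[OF bound[OF c'(1)]] by simp
    then have "c' = c"
      using min[OF asymptotic_bound_midpoint[OF c'(2) bound[OF c(1) F(1)]]] by simp
    have "y \<noteq> 0"
    proof
      assume "y = 0"
      then have "eventually (\<lambda>k. (x k - c) \<bullet> y < e) sequentially" using e by simp
      then show False using \<open>\<not> eventually _ _\<close> by blast
    qed
    \<comment> \<open>This \<open>s\<close> minimizes
      \<open>- 2 * s * e + s\<^sup>2 * (norm y)\<^sup>2\<close>, and the minimum is
      \<open>- s * e\<close>.\<close>
    define s where "s = e / (norm y)\<^sup>2"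
    have "s > 0" using e \<open>y \<noteq> 0\<close> by (simp add: s_def)
    have "asymptotic_bound F x (c + s *\<^sub>R y) (d c - s * e)"
      unfolding asymptotic_bound_def
    proof (intro allI impI)
      fix h :: real assume "h > 0"
      then have "eventually (\<lambda>k. (norm (x k - c))\<^sup>2 < d c + h) F"
        using bound[OF c(1) F(1)] by (auto simp: asymptotic_bound_def)
      moreover have "eventually (\<lambda>k. (x k - c) \<bullet> y \<ge> e) F"
        by (simp add: F_def eventually_inf_principal)
      ultimately show "eventually (\<lambda>k. (norm (x k - (c + s *\<^sub>R y)))\<^sup>2 < d c - s * e + h) F"
      proof eventually_elim
        case (elim k)
        have "(norm (x k - (c + s *\<^sub>R y)))\<^sup>2
            = (norm (x k - c))\<^sup>2 - 2 * s * ((x k - c) \<bullet> y) + s * (s * (norm y)\<^sup>2)"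
          unfolding power2_norm_eq_inner by (simp add: inner_simps inner_commute algebra_simps)
        moreover have "s * (s * (norm y)\<^sup>2) = s * e" using \<open>y \<noteq> 0\<close> by (simp add: s_def)
        moreover have "s * e \<le> s * ((x k - c) \<bullet> y)" using elim \<open>s > 0\<close> by simp
        ultimately show ?case using elim by linarith
      qed
    qed
    from min[OF this] show False using \<open>c' = c\<close> \<open>s > 0\<close> e by (simp add: mult_le_0_iff)
  qed
  then show ?thesis using that c(1) by blast
qed

section \<open>Relaxed iterations of averaged maps\<close>

text \<open>Here \<open>u\<close> and \<open>v\<close> stand for consecutive residuals
  \<open>z k - T (z k)\<close> and \<open>z (Suc k) - T (z (Suc k))\<close>. Then
  \<open>l *\<^sub>R u\<close> is the step between the iterates and
  \<open>l *\<^sub>R u - (u - v)\<close> the difference of their images, so the premise is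
  averagedness of \<open>T\<close>.\<close>

lemma relaxed_averaged_residual_le:
  fixes u v :: "'a::real_inner"
  assumes "(norm (l *\<^sub>R u - (u - v)))\<^sup>2 + q * (norm (u - v))\<^sup>2 \<le> (norm (l *\<^sub>R u))\<^sup>2"
    and "0 < l" "l \<le> 1 + q"
  shows "norm v \<le> norm u"
proof -
  have norm_diff: "(norm (x - y))\<^sup>2 = (norm x)\<^sup>2 - 2 * (x \<bullet> y) + (norm y)\<^sup>2" for x y :: 'a
    unfolding power2_norm_eq_inner by (simp add: inner_diff_left inner_diff_right inner_commute)
  have "(norm (l *\<^sub>R u - (u - v)))\<^sup>2 = (norm (l *\<^sub>R u))\<^sup>2 - 2 * l * (u \<bullet> (u - v)) + (norm (u - v))\<^sup>2"
    using norm_diff[of "l *\<^sub>R u" "u - v"] by (simp only: inner_scaleR_left mult.assoc)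
  then have "(norm (u - v))\<^sup>2 + q * (norm (u - v))\<^sup>2 \<le> 2 * l * (u \<bullet> (u - v))"
    using assms(1) by linarith
  moreover have "l * (norm (u - v))\<^sup>2 \<le> (1 + q) * (norm (u - v))\<^sup>2"
    using assms(3) by (intro mult_right_mono) auto
  moreover have "(1 + q) * (norm (u - v))\<^sup>2 = (norm (u - v))\<^sup>2 + q * (norm (u - v))\<^sup>2"
    by (simp add: distrib_right)
  ultimately have "l * (norm (u - v))\<^sup>2 \<le> l * (2 * (u \<bullet> (u - v)))" by linarith
  then have "(norm (u - v))\<^sup>2 \<le> 2 * (u \<bullet> (u - v))" using assms(2) by simp
  moreover have "(norm v)\<^sup>2 = (norm u)\<^sup>2 - 2 * (u \<bullet> (u - v)) + (norm (u - v))\<^sup>2"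
    using norm_diff[of u "u - v"] by simp
  ultimately have "(norm v)\<^sup>2 \<le> (norm u)\<^sup>2" by linarith
  then show ?thesis by (rule power2_le_imp_le) simp
qed

text \<open>For \<open>u\<close> the difference to a fixed point and \<open>r\<close> the residual.
  Cancelling the squared norm of \<open>u\<close> in the premise leaves a bound on
  \<open>2 * (u \<bullet> r)\<close>, which can be multiplied by \<open>l\<close>.\<close>

lemma relaxed_averaged_step:
  fixes u r :: "'a::real_inner"
  assumes "(norm (u + r))\<^sup>2 + q * (norm r)\<^sup>2 + g \<le> (norm u)\<^sup>2" and "0 \<le> l"
  shows "(norm (u + l *\<^sub>R r))\<^sup>2 + (1 + q - l) * l * (norm r)\<^sup>2 + l * g \<le> (norm u)\<^sup>2"
proof -
  have "2 * (u \<bullet> r) + (1 + q) * (norm r)\<^sup>2 + g \<le> 0"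
    using assms(1) unfolding power2_norm_eq_inner by (simp add: inner_simps inner_commute algebra_simps)
  then have "l * (2 * (u \<bullet> r) + (1 + q) * (norm r)\<^sup>2 + g) \<le> 0"
    using assms(2) by (simp add: mult_le_0_iff)
  then show ?thesis
    unfolding power2_norm_eq_inner by (simp add: inner_simps inner_commute algebra_simps)
qed

text \<open>If \<open>a n\<close> is at least \<open>e\<close>, so are all earlier terms, and the
  weighted sum exceeds \<open>M\<close> once the weights sum to more than
  \<open>M / e\<close>.\<close>

lemma decseq_null_if_weighted_sum_bounded:
  fixes a :: "nat \<Rightarrow> real"
  assumes "decseq a" "\<And>k. 0 \<le> a k" "\<And>k. 0 \<le> t k"
    and div: "filterlim (\<lambda>n. \<Sum>i<n. t i) at_top sequentially"
    and bound: "\<And>n. (\<Sum>i<n. t i * a i) \<le> M"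
  shows "a \<longlonglongrightarrow> 0"
proof (rule tendstoI)
  fix e :: real assume e: "e > 0"
  obtain n where n: "(\<Sum>i<n. t i) > M / e"
    using div unfolding filterlim_at_top_dense by (auto simp: eventually_sequentially)
  have "a n < e"
  proof (rule ccontr)
    assume "\<not> a n < e"
    then have "e \<le> a i" if "i < n" for i
      using decseqD[OF assms(1), of i n] that by simp
    then have "(\<Sum>i<n. t i * e) \<le> (\<Sum>i<n. t i * a i)"
      using assms(3) by (intro sum_mono mult_left_mono) auto
    also note bound
    finally have "(\<Sum>i<n. t i) * e \<le> M" by (simp add: sum_distrib_right)
    then show False using n e by (simp add: field_simps)
  qed
  then have "dist (a k) 0 < e" if "k \<ge> n" for k
    using decseqD[OF assms(1) that] assms(2)[of k] by simp
  then show "eventually (\<lambda>k. dist (a k) 0 < e) sequentially"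
    by (auto simp: eventually_sequentially)
qed

text \<open>By monotonicity, \<open>(k + 1) * a k\<close> is at most twice the sum over the last
  half of the indices up to \<open>k\<close>, and such blocks of a convergent series tend to
  0.\<close>

lemma decseq_summable_smallo:
  fixes a :: "nat \<Rightarrow> real"
  assumes "decseq a" "\<And>k. 0 \<le> a k" "summable a"
  shows "a \<in> o(\<lambda>k. 1 / (real k + 1))"
proof (rule smalloI_tendsto)
  have "(\<lambda>k. (real k + 1) * a k) \<longlonglongrightarrow> 0"
  proof (rule tendsto_sandwich[OF _ _ tendsto_const])
    define s where "s n = (\<Sum>i<n. a i)" for n
    have s: "s \<longlonglongrightarrow> suminf a" unfolding s_def using assms(3) by (rule summable_LIMSEQ)
    have half: "filterlim (\<lambda>k. Suc k div 2) sequentially sequentially"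
      unfolding filterlim_at_top
    proof
      fix N :: nat
      show "eventually (\<lambda>k. N \<le> Suc k div 2) sequentially"
        by (rule eventually_sequentiallyI[of "2 * N"]) linarith
    qed
    have "(\<lambda>k. s (Suc k)) \<longlonglongrightarrow> suminf a" using s by (rule LIMSEQ_Suc)
    moreover have "(\<lambda>k. s (Suc k div 2)) \<longlonglongrightarrow> suminf a" using s half by (rule filterlim_compose)
    ultimately have "(\<lambda>k. s (Suc k) - s (Suc k div 2)) \<longlonglongrightarrow> suminf a - suminf a" by (rule tendsto_diff)
    then have "(\<lambda>k. 2 * (s (Suc k) - s (Suc k div 2))) \<longlonglongrightarrow> 2 * (suminf a - suminf a)"
      by (rule tendsto_mult_left)
    then show "(\<lambda>k. 2 * (s (Suc k) - s (Suc k div 2))) \<longlonglongrightarrow> 0" by simp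
    have "(real k + 1) * a k \<le> 2 * (s (Suc k) - s (Suc k div 2))" for k
    proof -
      \<comment> \<open>The block from \<open>h\<close> to \<open>k\<close> has at least half of
        \<open>k + 1\<close> terms.\<close>
      define h where "h = Suc k div 2"
      have h: "h \<le> Suc k" "Suc k \<le> 2 * (Suc k - h)" unfolding h_def by presburger+
      have "real (Suc k) \<le> real (2 * (Suc k - h))" using h(2) by (rule of_nat_mono)
      then have "(real k + 1) * a k \<le> (2 * real (Suc k - h)) * a k"
        using assms(2) by (intro mult_right_mono) simp_all
      also have "\<dots> = 2 * (\<Sum>i = h..<Suc k. a k)" by simp
      also have "\<dots> \<le> 2 * (\<Sum>i = h..<Suc k. a i)"
        by (intro mult_left_mono sum_mono decseqD[OF assms(1)]) simp_all
      also have "(\<Sum>i = h..<Suc k. a i) = s (Suc k) - s h"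
        using sum_diff_nat_ivl[of 0 h "Suc k" a] h(1) by (simp only: s_def lessThan_atLeast0 le0)
      finally show ?thesis by (simp only: h_def)
    qed
    then show "eventually (\<lambda>k. (real k + 1) * a k \<le> 2 * (s (Suc k) - s (Suc k div 2))) sequentially"
      by simp
  qed (use assms(2) in simp)
  then show "(\<lambda>k. a k / (1 / (real k + 1))) \<longlonglongrightarrow> 0" by (simp add: mult.commute)
  show "eventually (\<lambda>k. 1 / (real k + 1) \<noteq> 0) sequentially" by (auto intro!: always_eventually)
qed

section \<open>Three-operator splitting\<close>

text \<open>The letters stand for differences between two points: \<open>z\<close> of the arguments,
  \<open>b\<close> and \<open>a\<close> of the resolvent values for B and A, \<open>c\<close> of the
  values of C. An exact identity is combined with cocoercivity and Young's inequality; the last two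
  inner products on the left are the monotonicity terms of B and A.\<close>

lemma three_operator_estimate:
  fixes z a b c :: "'a::real_inner"
  assumes "\<epsilon> > 0" "\<gamma> > 0" and coco: "c \<bullet> b \<ge> \<beta> * (norm c)\<^sup>2"
  shows "(norm (z - b + a))\<^sup>2 + (1 - \<epsilon>) * (norm (a - b))\<^sup>2 + \<gamma> * (2 * \<beta> - \<gamma> / \<epsilon>) * (norm c)\<^sup>2
      + 2 * (b \<bullet> (z - b)) + 2 * (a \<bullet> (2 *\<^sub>R b - z - \<gamma> *\<^sub>R c - a)) \<le> (norm z)\<^sup>2"
proof -
  \<comment> \<open>Young's inequality with weight \<epsilon>: the residual term pays \<epsilon> and
    keeps 1 - \<epsilon>, while cocoercivity pays
    \<open>\<gamma>\<^sup>2 / \<epsilon>\<close>.\<close>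
  have "0 \<le> (norm (\<gamma> *\<^sub>R c + \<epsilon> *\<^sub>R (a - b)))\<^sup>2 / \<epsilon>" using assms by simp
  also have "\<dots> = \<gamma>\<^sup>2 / \<epsilon> * (norm c)\<^sup>2 + 2 * \<gamma> * (c \<bullet> (a - b)) + \<epsilon> * (norm (a - b))\<^sup>2"
    using assms(1) unfolding power2_norm_eq_inner
    by (simp add: inner_simps inner_commute field_simps power2_eq_square)
  finally have young: "0 \<le> \<gamma>\<^sup>2 / \<epsilon> * (norm c)\<^sup>2 + 2 * \<gamma> * (c \<bullet> (a - b)) + \<epsilon> * (norm (a - b))\<^sup>2" .
  have "2 * \<gamma> * (\<beta> * (norm c)\<^sup>2) \<le> 2 * \<gamma> * (c \<bullet> b)"
    using coco assms(2) by (intro mult_left_mono) auto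
  moreover have "(norm (z - b + a))\<^sup>2 + (norm (a - b))\<^sup>2
      + 2 * (b \<bullet> (z - b)) + 2 * (a \<bullet> (2 *\<^sub>R b - z - \<gamma> *\<^sub>R c - a)) + 2 * \<gamma> * (c \<bullet> a) = (norm z)\<^sup>2"
    unfolding power2_norm_eq_inner by (simp add: inner_simps inner_commute algebra_simps)
  moreover have "2 * \<gamma> * (c \<bullet> (a - b)) = 2 * \<gamma> * (c \<bullet> a) - 2 * \<gamma> * (c \<bullet> b)"
    by (simp add: inner_simps algebra_simps)
  moreover have "\<gamma> * (2 * \<beta> - \<gamma> / \<epsilon>) * (norm c)\<^sup>2 = 2 * \<gamma> * (\<beta> * (norm c)\<^sup>2) - \<gamma>\<^sup>2 / \<epsilon> * (norm c)\<^sup>2"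
    by (simp add: algebra_simps power2_eq_square)
  moreover have "(1 - \<epsilon>) * (norm (a - b))\<^sup>2 = (norm (a - b))\<^sup>2 - \<epsilon> * (norm (a - b))\<^sup>2"
    by (simp add: algebra_simps)
  ultimately show ?thesis using young by linarith
qed

text \<open>Adding the two monotonicity inequalities at \<open>(x\<^sup>*, z\<^sup>* - x\<^sup>*)\<close> and at a point of the graph of
  \<open>A\<close>, the terms quadratic in \<open>x k\<close> cancel. Minty's theorem lets the latter point be perturbed by
  \<open>O(t)\<close> so that the sum reads \<open>t (x k - x\<^sup>*) \<bullet> w \<le> O(t\<^sup>2) + o(1)\<close>.\<close>

lemma splitting_weakly_converges:
  fixes A B :: "'a::{real_inner, complete_space} \<Rightarrow> 'a set"
  assumes A: "maximal_monotone_op A" and B: "monotone_op B"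
    and Bx: "\<And>k. z k - x k \<in> B (x k)" and Ay: "\<And>k. p k \<in> A (y k)"
    and xy: "(\<lambda>k. y k - x k) \<longlonglongrightarrow> 0" and pc: "(\<lambda>k. p k - (x k - z k)) \<longlonglongrightarrow> - c"
    and zw: "weakly_converges z zs" and zb: "bounded (range z)" and xb: "bounded (range x)"
    and Bxs: "zs - xs \<in> B xs" and Axs: "xs - zs - c \<in> A xs"
  shows "weakly_converges x xs"
proof (rule weakly_converges_if_eventually_less)
  fix w :: 'a and e :: real assume e: "e > 0"
  \<comment> \<open>Chosen so that \<open>t\<^sup>2 + t\<^sup>2 * (norm w)\<^sup>2\<close> equals
    \<open>t * e\<close>, which gives \<open>e\<close> after division by \<open>t\<close>.\<close>
  define t where "t = e / (1 + (norm w)\<^sup>2)"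
  have pos: "0 < 1 + (norm w)\<^sup>2" by (simp add: add_pos_nonneg)
  have t: "t > 0" "t * (1 + (norm w)\<^sup>2) = e" using e pos by (auto simp: t_def)
  \<comment> \<open>Without the perturbation \<open>t *\<^sub>R w\<close> the solution would be
    \<open>xs\<close>, by \<open>Axs\<close>; \<open>d\<close> measures the response to it.\<close>
  obtain a where a: "2 *\<^sub>R xs - zs - c + t *\<^sub>R w - a \<in> A a" using minty[OF A] .
  define d where "d = a - xs"
  have "d \<bullet> (t *\<^sub>R w - d) \<ge> 0"
    using monotone_opD[OF maximal_monotone_op_imp_monotone[OF A] a Axs]
    by (simp add: d_def scaleR_2 algebra_simps)
  moreover have "d \<bullet> (t *\<^sub>R w - d) = t * (d \<bullet> w) - d \<bullet> d"
    by (simp add: inner_diff_right)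
  moreover have "(norm (d - t *\<^sub>R w))\<^sup>2 = d \<bullet> d - 2 * (t * (d \<bullet> w)) + t\<^sup>2 * (norm w)\<^sup>2"
    unfolding power2_norm_eq_inner
    by (simp add: inner_diff_left inner_diff_right inner_commute power2_eq_square mult.assoc)
  ultimately have dt: "d \<bullet> (t *\<^sub>R w - d) \<le> t\<^sup>2 * (norm w)\<^sup>2"
    using inner_ge_zero[of d] zero_le_power2[of "norm (d - t *\<^sub>R w)"] by linarith
  define \<xi> where "\<xi> k = x k - xs" for k
  define \<zeta> where "\<zeta> k = z k - zs" for k
  define f where "f k = y k - x k" for k
  define g where "g k = p k - (x k - z k) + c" for k
  have f: "f \<longlonglongrightarrow> 0" using xy by (simp add: f_def[abs_def])
  have g: "g \<longlonglongrightarrow> 0" using tendsto_add[OF pc tendsto_const[of c]] by (simp add: g_def[abs_def])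
  have bdd_\<zeta>: "bounded (range \<zeta>)"
    using bounded_translation_minus[OF zb, of zs] unfolding \<zeta>_def[abs_def] image_image .
  have bdd_\<xi>: "bounded (range \<xi>)"
    using bounded_translation_minus[OF xb, of xs] unfolding \<xi>_def[abs_def] image_image .
  have null: "(\<lambda>k. u k \<bullet> v k) \<longlonglongrightarrow> 0" if "u \<longlonglongrightarrow> 0" "bounded (range v)" for u v :: "nat \<Rightarrow> 'a"
  proof -
    obtain K where K: "\<And>k. norm (v k) \<le> K" using \<open>bounded (range v)\<close> by (auto simp: bounded_iff)
    have "\<bar>u k \<bullet> v k\<bar> \<le> norm (u k) * K" for k
      using Cauchy_Schwarz_ineq2[of "u k" "v k"] mult_left_mono[OF K[of k] norm_ge_zero[of "u k"]] by linarith
    moreover have "(\<lambda>k. norm (u k) * K) \<longlonglongrightarrow> 0"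
      using tendsto_mult_right[OF tendsto_norm[OF that(1)], of K] by simp
    ultimately show ?thesis
      by (auto intro!: Lim_null_comparison[of _ "\<lambda>k. norm (u k) * K"] always_eventually)
  qed
  \<comment> \<open>Every summand tends to 0: a null sequence is paired with a bounded, null or
    constant one, and the last term is null by weak convergence of \<open>z\<close>.\<close>
  define r where "r k = f k \<bullet> \<xi> k - f k \<bullet> \<zeta> k + f k \<bullet> g k + f k \<bullet> (d - t *\<^sub>R w) + g k \<bullet> \<xi> k - g k \<bullet> d
    + \<zeta> k \<bullet> d" for k
  have "(\<lambda>k. z k \<bullet> d - zs \<bullet> d) \<longlonglongrightarrow> 0"
    using zw unfolding weakly_converges_def by (intro LIM_zero) blast
  then have \<zeta>d: "(\<lambda>k. \<zeta> k \<bullet> d) \<longlonglongrightarrow> 0"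
    by (simp add: \<zeta>_def inner_diff_left)
  have inner_null: "(\<lambda>k. u k \<bullet> v) \<longlonglongrightarrow> 0" if "u \<longlonglongrightarrow> 0" for u :: "nat \<Rightarrow> 'a" and v
    using tendsto_inner[OF that tendsto_const[of v]] by simp
  have fg: "(\<lambda>k. f k \<bullet> g k) \<longlonglongrightarrow> 0" using tendsto_inner[OF f g] by simp
  have "(\<lambda>k. f k \<bullet> \<xi> k - f k \<bullet> \<zeta> k + f k \<bullet> g k + f k \<bullet> (d - t *\<^sub>R w) + g k \<bullet> \<xi> k - g k \<bullet> d
    + \<zeta> k \<bullet> d) \<longlonglongrightarrow> 0 - 0 + 0 + 0 + 0 - 0 + 0"
    by (intro tendsto_add tendsto_diff null[OF f bdd_\<xi>] null[OF f bdd_\<zeta>] fg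
        inner_null[OF f] null[OF g bdd_\<xi>] inner_null[OF g] \<zeta>d)
  then have "r \<longlonglongrightarrow> 0" by (simp add: r_def[abs_def])
  then have "eventually (\<lambda>k. r k < t\<^sup>2) sequentially"
    using t by (intro order_tendstoD(2)) auto
  then show "eventually (\<lambda>k. (x k - xs) \<bullet> w < e) sequentially"
  proof eventually_elim
    case (elim k)
    have "0 \<le> \<xi> k \<bullet> (\<zeta> k - \<xi> k)"
      using monotone_opD[OF B Bx[of k] Bxs] by (simp add: \<xi>_def \<zeta>_def algebra_simps)
    moreover have "0 \<le> (\<xi> k + f k - d) \<bullet> (\<xi> k - \<zeta> k + g k - t *\<^sub>R w + d)"
    proof -
      have "\<xi> k + f k - d = y k - a" by (simp add: \<xi>_def f_def d_def)
      moreover have "\<xi> k - \<zeta> k + g k - t *\<^sub>R w + d = p k - (2 *\<^sub>R xs - zs - c + t *\<^sub>R w - a)"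
        by (simp add: \<xi>_def \<zeta>_def g_def d_def scaleR_2)
      ultimately show ?thesis
        using monotone_opD[OF maximal_monotone_op_imp_monotone[OF A] Ay[of k] a] by (simp only:)
    qed
    \<comment> \<open>The products of \<open>\<xi> k\<close> with \<open>d\<close> cancel along with
      the quadratic terms, so outside \<open>r k\<close> only the product with \<open>w\<close>
      involves \<open>\<xi> k\<close>.\<close>
    moreover have "\<xi> k \<bullet> (\<zeta> k - \<xi> k) + (\<xi> k + f k - d) \<bullet> (\<xi> k - \<zeta> k + g k - t *\<^sub>R w + d)
        = r k + d \<bullet> (t *\<^sub>R w - d) - t * (\<xi> k \<bullet> w)"
      by (simp add: r_def inner_diff_left inner_diff_right inner_add_left inner_add_right inner_commute)
    ultimately have "t * (\<xi> k \<bullet> w) \<le> r k + d \<bullet> (t *\<^sub>R w - d)" by linarith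
    also have "\<dots> < t\<^sup>2 + t\<^sup>2 * (norm w)\<^sup>2" using elim dt by linarith
    also have "\<dots> = t * e" unfolding t(2)[symmetric] by (simp add: power2_eq_square distrib_left)
    finally show ?case using t(1) by (simp add: \<xi>_def)
  qed
qed

text \<open>At distance at least \<open>e\<close> the inner product would be at least \<phi> e, by
  monotonicity of the modulus, whereas it eventually drops below this positive value.\<close>

lemma uniformly_monotone_tendsto:
  assumes "uniformly_monotone_on (insert xs (range x)) A"
    and u: "\<And>k. u k \<in> A (x k)" "us \<in> A xs"
    and lim: "(\<lambda>k. (x k - xs) \<bullet> (u k - us)) \<longlonglongrightarrow> 0"
  shows "x \<longlonglongrightarrow> xs"
proof (rule tendstoI)
  obtain \<phi> :: "real \<Rightarrow> ereal" where mono: "mono_on {0..} \<phi>"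
    and \<phi>: "\<forall>t\<ge>0. \<phi> t \<ge> 0 \<and> (\<phi> t = 0 \<longleftrightarrow> t = 0)"
    and ineq: "\<forall>a\<in>insert xs (range x). \<forall>b\<in>insert xs (range x). \<forall>v\<in>A a. \<forall>w\<in>A b.
      \<phi> (norm (a - b)) \<le> ereal ((a - b) \<bullet> (v - w))"
    using assms(1) unfolding uniformly_monotone_on_def by (elim conjE exE)
  have le: "\<phi> (norm (x k - xs)) \<le> ereal ((x k - xs) \<bullet> (u k - us))" for k
    using ineq[rule_format, OF _ _ u(1)[of k] u(2)] by simp
  fix e :: real assume e: "e > 0"
  then have "0 < \<phi> e" using \<phi>[rule_format, of e] by (simp add: order_less_le)
  moreover have "(\<lambda>k. ereal ((x k - xs) \<bullet> (u k - us))) \<longlonglongrightarrow> 0"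
    using lim by (simp add: zero_ereal_def)
  ultimately have "eventually (\<lambda>k. ereal ((x k - xs) \<bullet> (u k - us)) < \<phi> e) sequentially"
    by (intro order_tendstoD(2))
  then show "eventually (\<lambda>k. dist (x k) xs < e) sequentially"
  proof eventually_elim
    case (elim k)
    show ?case
    proof (rule ccontr)
      assume "\<not> dist (x k) xs < e"
      then have "\<phi> e \<le> \<phi> (norm (x k - xs))"
        using e by (intro mono_onD[OF mono]) (auto simp: dist_norm)
      then show False using le[of k] elim by simp
    qed
  qed
qed

lemma scale_op_mem_iff: "c \<noteq> 0 \<Longrightarrow> u \<in> scale_op c A x \<longleftrightarrow> u /\<^sub>R c \<in> A x"
  by (force simp: scale_op_def intro: image_eqI[of _ _ "u /\<^sub>R c"])

text \<open>At two zeros, monotonicity of A and B makes \<open>(C x - C y) \<bullet> (x - y)\<close>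
  nonpositive, against cocoercivity. This carries results about C from one zero to all of
  them.\<close>

lemma cocoercive_zer_sum_unique:
  assumes A: "monotone_op A" and B: "monotone_op B" and C: "cocoercive \<beta> C" "\<beta> > 0"
    and x: "x \<in> zer (plus_op (plus_op A B) (single_op C))"
    and y: "y \<in> zer (plus_op (plus_op A B) (single_op C))"
  shows "C x = C y"
proof -
  obtain u v where u: "u \<in> A x" "v \<in> B x" "0 = u + v + C x"
    using x by (auto simp: zer_def plus_op_def single_op_def)
  obtain u' v' where u': "u' \<in> A y" "v' \<in> B y" "0 = u' + v' + C y"
    using y by (auto simp: zer_def plus_op_def single_op_def)
  have "C x - C y = - ((u - u') + (v - v'))"
    using u(3) u'(3) by (metis add.commute add_diff_add diff_0 minus_diff_eq add_diff_cancel_left' neg_eq_iff_add_eq_0)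
  then have "(C x - C y) \<bullet> (x - y) = - ((x - y) \<bullet> (u - u')) - (x - y) \<bullet> (v - v')"
    by (simp add: inner_diff_left inner_diff_right inner_add_right inner_commute)
  moreover have "\<beta> * (norm (C x - C y))\<^sup>2 \<le> (C x - C y) \<bullet> (x - y)"
    using C(1) by (simp add: cocoercive_def)
  ultimately have "\<beta> * (norm (C x - C y))\<^sup>2 \<le> 0"
    using monotone_opD[OF A u(1) u'(1)] monotone_opD[OF B u(2) u'(2)] by linarith
  then show ?thesis using C(2) by (simp add: mult_le_0_iff)
qed

lemma sum_telescope_le:
  fixes d h :: "nat \<Rightarrow> real"
  assumes "\<And>k. d (Suc k) + h k \<le> d k"
  shows "(\<Sum>i<n. h i) + d n \<le> d 0"
proof (induction n)
  case (Suc n)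
  then show ?case using assms[of n] by simp
qed simp

theorem theorem3p1:
  fixes A B :: "'a::{real_inner, complete_space} \<Rightarrow> 'a set"
    and C JA JB xA T :: "'a \<Rightarrow> 'a"
    and \<beta> \<epsilon> \<gamma> \<alpha> :: real
    and lam \<tau> :: "nat \<Rightarrow> real"
    and z :: "nat \<Rightarrow> 'a"
    and Z :: "'a set"
  assumes A: "maximal_monotone_op A"
    and B: "maximal_monotone_op B"
    and \<beta>: "\<beta> > 0"
    and C: "cocoercive \<beta> C"
    and \<epsilon>: "0 < \<epsilon>" "\<epsilon> < 1"
    and \<gamma>: "0 < \<gamma>" "\<gamma> < 2 * \<beta> * \<epsilon>"
    and \<alpha>: "\<alpha> = 1 / (2 - \<epsilon>)"
    and JA: "JA = resolvent (scale_op \<gamma> A)"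
    and JB: "JB = resolvent (scale_op \<gamma> B)"
    and xA: "xA = (\<lambda>w. JA (2 *\<^sub>R JB w - w - \<gamma> *\<^sub>R C (JB w)))"
    and T: "T = (\<lambda>w. w - JB w + xA w)"
    and Z: "Z = zer (plus_op (plus_op A B) (single_op C))"
    and Fix_T: "Fix T \<noteq> {}"
    and lam: "\<forall>j. 0 < lam j \<and> lam j < 1 / \<alpha>"
    and \<tau>: "\<forall>k. \<tau> k = (1 - \<alpha> * lam k) * lam k / \<alpha>"
    and \<tau>_sum: "filterlim (\<lambda>n. \<Sum>i<n. \<tau> i) at_top sequentially"
    and z: "\<forall>k. z (Suc k) = z k + lam k *\<^sub>R (T (z k) - z k)"
  shows
    "(\<forall>zs\<in>Fix T. decseq (\<lambda>j. norm (z j - zs)))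
    \<and> (decseq (\<lambda>j. norm (T (z j) - z j)) \<and> (\<lambda>j. norm (T (z j) - z j)) \<longlonglongrightarrow> 0)
    \<and> (\<exists>zs\<in>Fix T. weakly_converges z zs)
    \<and> (\<forall>xs\<in>Z. \<forall>zs\<in>Fix T. (INF j. lam j) > 0 \<longrightarrow>
        summable (\<lambda>i. lam i * (norm (C (JB (z i)) - C xs))\<^sup>2)
        \<and> (\<Sum>i. lam i * (norm (C (JB (z i)) - C xs))\<^sup>2)
            \<le> 1 / (\<gamma> * (2 * \<beta> - \<gamma> / \<epsilon>)) * (norm (z 0 - zs))\<^sup>2
        \<and> (\<lambda>j. C (JB (z j))) \<longlonglongrightarrow> C xs)
    \<and> ((INF j. lam j) > 0 \<longrightarrow>
        (\<forall>zs. weakly_converges z zs \<longrightarrow>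
          weakly_converges (\<lambda>j. JB (z j)) (JB zs) \<and> JB zs \<in> Z))
    \<and> ((INF j. lam j) > 0 \<longrightarrow>
        (\<forall>zs. weakly_converges z zs \<longrightarrow>
          weakly_converges (\<lambda>j. xA (z j)) (JB zs) \<and> JB zs \<in> Z))
    \<and> ((INF j. \<tau> j) > 0 \<longrightarrow>
        (\<forall>zs\<in>Fix T. \<forall>k. (norm (T (z k) - z k))\<^sup>2
            \<le> (norm (z 0 - zs))\<^sup>2 / ((INF j. \<tau> j) * (real k + 1)))
        \<and> (\<lambda>k. (norm (T (z k) - z k))\<^sup>2) \<in> o(\<lambda>k. 1 / (real k + 1)))
    \<and> ((\<forall>S. S \<noteq> {} \<and> bounded S \<and> S \<subseteq> dom_op A \<longrightarrow> uniformly_monotone_on S A)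
      \<or> (\<forall>S. S \<noteq> {} \<and> bounded S \<and> S \<subseteq> dom_op B \<longrightarrow> uniformly_monotone_on S B)
      \<or> (\<forall>x\<in>Z. demiregular_at C x)
      \<longrightarrow> (\<exists>x\<in>Z. (\<lambda>j. JB (z j)) \<longlonglongrightarrow> x \<and> (\<lambda>j. xA (z j)) \<longlonglongrightarrow> x))"
proof -

  \<comment> \<open>Resolvent inclusions and the averagedness estimate\<close>
  define q where "q w = 2 *\<^sub>R JB w - w - \<gamma> *\<^sub>R C (JB w)" for w
  \<comment> \<open>\<open>pA w\<close> and \<open>pB w\<close> are the elements of \<gamma> A and
    \<gamma> B that Minty's theorem attaches to the resolvent values \<open>xA w\<close> and
    \<open>JB w\<close>.\<close>
  define pA where "pA w = q w - xA w" for w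
  define pB where "pB w = w - JB w" for w
  define MA where "MA w v = (xA w - xA v) \<bullet> (pA w - pA v)" for w v
  define MB where "MB w v = (JB w - JB v) \<bullet> (pB w - pB v)" for w v
  define \<kappa> where "\<kappa> = \<gamma> * (2 * \<beta> - \<gamma> / \<epsilon>)"
  define g where "g w v = \<kappa> * (norm (C (JB w) - C (JB v)))\<^sup>2 + 2 * MB w v + 2 * MA w v" for w v
  have A': "maximal_monotone_op (scale_op \<gamma> A)" and B': "maximal_monotone_op (scale_op \<gamma> B)"
    using maximal_monotone_op_scale[OF A \<gamma>(1)] maximal_monotone_op_scale[OF B \<gamma>(1)] .
  have mono_A: "monotone_op A" and mono_B: "monotone_op B"
    using maximal_monotone_op_imp_monotone[OF A] maximal_monotone_op_imp_monotone[OF B] .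
  have mono_A': "monotone_op (scale_op \<gamma> A)" and mono_B': "monotone_op (scale_op \<gamma> B)"
    using maximal_monotone_op_imp_monotone[OF A'] maximal_monotone_op_imp_monotone[OF B'] .
  have pA_mem: "pA w \<in> scale_op \<gamma> A (xA w)" for w
    using resolvent_mem[OF A'] by (simp add: pA_def q_def xA JA)
  have pB_mem: "pB w \<in> scale_op \<gamma> B (JB w)" for w
    using resolvent_mem[OF B'] by (simp add: pB_def JB)
  have MA_nonneg: "0 \<le> MA w v" for w v
    unfolding MA_def by (rule monotone_opD[OF mono_A' pA_mem pA_mem])
  have MB_nonneg: "0 \<le> MB w v" for w v
    unfolding MB_def by (rule monotone_opD[OF mono_B' pB_mem pB_mem])
  have T_diff: "T w - w = xA w - JB w" for w by (simp add: T)
  have "\<gamma> / \<epsilon> < 2 * \<beta>" using \<gamma>(2) \<epsilon>(1) by (simp add: divide_less_eq)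
  then have \<kappa>: "\<kappa> > 0" using \<gamma>(1) by (simp add: \<kappa>_def)
  have g_nonneg: "0 \<le> g w v" for w v
    using MA_nonneg[of w v] MB_nonneg[of w v] \<kappa> by (simp add: g_def)
  have estimate: "(norm (T w - T v))\<^sup>2 + (1 - \<epsilon>) * (norm ((T w - w) - (T v - v)))\<^sup>2 + g w v
      \<le> (norm (w - v))\<^sup>2" for w v
  proof -
    let ?b = "JB w - JB v" and ?a = "xA w - xA v" and ?c = "C (JB w) - C (JB v)"
    have "?c \<bullet> ?b \<ge> \<beta> * (norm ?c)\<^sup>2" using C by (simp add: cocoercive_def)
    from three_operator_estimate[OF \<epsilon>(1) \<gamma>(1) this, of "w - v" ?a]
    have "(norm (w - v - ?b + ?a))\<^sup>2 + (1 - \<epsilon>) * (norm (?a - ?b))\<^sup>2 + \<kappa> * (norm ?c)\<^sup>2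
      + 2 * (?b \<bullet> (w - v - ?b)) + 2 * (?a \<bullet> (2 *\<^sub>R ?b - (w - v) - \<gamma> *\<^sub>R ?c - ?a)) \<le> (norm (w - v))\<^sup>2"
      by (simp only: \<kappa>_def)
    moreover have "w - v - ?b + ?a = T w - T v" "?a - ?b = (T w - w) - (T v - v)" by (simp_all add: T)
    moreover have "w - v - ?b = pB w - pB v" by (simp add: pB_def)
    moreover have "2 *\<^sub>R ?b - (w - v) - \<gamma> *\<^sub>R ?c - ?a = pA w - pA v"
      by (simp add: pA_def q_def scaleR_diff_right)
    ultimately show ?thesis by (simp only: g_def MA_def MB_def add.assoc)
  qed
  have nonexp: "norm (T w - T v) \<le> norm (w - v)" for w v
  proof (rule power2_le_imp_le)
    have "0 \<le> (1 - \<epsilon>) * (norm ((T w - w) - (T v - v)))\<^sup>2" using \<epsilon>(2) by simp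
    then show "(norm (T w - T v))\<^sup>2 \<le> (norm (w - v))\<^sup>2"
      using estimate[of w v] g_nonneg[of w v] by linarith
  qed simp
  have JB_nonexp: "norm (JB w - JB v) \<le> norm (w - v)" for w v
  proof -
    have "(norm (JB w - JB v))\<^sup>2 \<le> (JB w - JB v) \<bullet> (w - v)"
      using MB_nonneg[of w v] unfolding power2_norm_eq_inner MB_def pB_def
      by (simp add: inner_diff_left inner_diff_right)
    also have "\<dots> \<le> norm (JB w - JB v) * norm (w - v)" by (rule norm_cauchy_schwarz)
    finally show ?thesis by (cases "JB w = JB v") (simp_all add: power2_eq_square)
  qed

  \<comment> \<open>Fejer monotonicity and vanishing residuals\<close>
  have inv_\<alpha>: "1 / \<alpha> = 2 - \<epsilon>" by (simp add: \<alpha>)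
  have lam_pos: "0 < lam k" and lam_less: "lam k < 2 - \<epsilon>" for k using lam inv_\<alpha> by auto
  \<comment> \<open>Writing 1 / \<alpha> as 1 + (1 - \<epsilon>) matches the weight in
    \<open>relaxed_averaged_step\<close> for q = 1 - \<epsilon>.\<close>
  have \<tau>_eq: "\<tau> k = (1 + (1 - \<epsilon>) - lam k) * lam k" for k
  proof -
    have "\<alpha> \<noteq> 0" using \<epsilon>(2) by (simp add: \<alpha>)
    then have "\<tau> k = (1 / \<alpha> - lam k) * lam k" using \<tau> by (simp add: field_simps)
    then show ?thesis unfolding inv_\<alpha> by simp
  qed
  have \<tau>_pos: "0 < \<tau> k" for k using lam_pos[of k] lam_less[of k] by (simp add: \<tau>_eq)
  define a where "a k = (norm (T (z k) - z k))\<^sup>2" for k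
  have step: "(norm (z (Suc k) - zs))\<^sup>2 + (\<tau> k * a k + lam k * g (z k) zs) \<le> (norm (z k - zs))\<^sup>2"
    if "zs \<in> Fix T" for zs k
  proof -
    have "T zs = zs" using that by (simp add: Fix_def)
    then have "(norm ((z k - zs) + (T (z k) - z k)))\<^sup>2 + (1 - \<epsilon>) * (norm (T (z k) - z k))\<^sup>2 + g (z k) zs
        \<le> (norm (z k - zs))\<^sup>2"
      using estimate[of "z k" zs] by simp
    from relaxed_averaged_step[OF this less_imp_le[OF lam_pos[of k]]]
    have "(norm (z k - zs + lam k *\<^sub>R (T (z k) - z k)))\<^sup>2
      + \<tau> k * a k + lam k * g (z k) zs \<le> (norm (z k - zs))\<^sup>2"
      by (simp only: \<tau>_eq a_def)
    moreover have "z k - zs + lam k *\<^sub>R (T (z k) - z k) = z (Suc k) - zs" using z by simp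
    ultimately show ?thesis by (simp only: add.assoc)
  qed
  have a_nonneg: "0 \<le> a k" for k by (simp add: a_def)
  have h_nonneg: "0 \<le> \<tau> k * a k" "0 \<le> lam k * g (z k) zs" for k zs
    using less_imp_le[OF \<tau>_pos] less_imp_le[OF lam_pos] a_nonneg g_nonneg by simp_all
  have fejer: "decseq (\<lambda>k. norm (z k - zs))" if "zs \<in> Fix T" for zs
  proof (rule decseq_SucI, rule power2_le_imp_le)
    show "(norm (z (Suc k) - zs))\<^sup>2 \<le> (norm (z k - zs))\<^sup>2" for k
      using step[OF that, of k] h_nonneg(1)[of k] h_nonneg(2)[of k zs] by linarith
  qed simp
  have z_bound: "norm (z k - zs) \<le> norm (z 0 - zs)" if "zs \<in> Fix T" for zs k
    using decseqD[OF fejer[OF that], of 0 k] by simp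
  have sum_\<tau>: "(\<Sum>i<n. \<tau> i * a i) \<le> (norm (z 0 - zs))\<^sup>2"
    and sum_lam: "(\<Sum>i<n. lam i * g (z i) zs) \<le> (norm (z 0 - zs))\<^sup>2" if "zs \<in> Fix T" for zs n
  proof -
    have "(\<Sum>i<n. \<tau> i * a i) + (\<Sum>i<n. lam i * g (z i) zs) \<le> (norm (z 0 - zs))\<^sup>2"
      using sum_telescope_le[where d="\<lambda>k. (norm (z k - zs))\<^sup>2", OF step[OF that], of n]
        zero_le_power2[of "norm (z n - zs)"] by (simp only: sum.distrib)
    moreover have "0 \<le> (\<Sum>i<n. \<tau> i * a i)" "0 \<le> (\<Sum>i<n. lam i * g (z i) zs)"
      by (intro sum_nonneg h_nonneg)+
    ultimately show "(\<Sum>i<n. \<tau> i * a i) \<le> (norm (z 0 - zs))\<^sup>2"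
      and "(\<Sum>i<n. lam i * g (z i) zs) \<le> (norm (z 0 - zs))\<^sup>2" by linarith+
  qed
  have dec_res: "decseq (\<lambda>k. norm (T (z k) - z k))"
  proof (rule decseq_SucI)
    fix k
    let ?u = "z k - T (z k)" and ?v = "z (Suc k) - T (z (Suc k))"
    have zu: "lam k *\<^sub>R ?u = z k - z (Suc k)" using z by (simp add: scaleR_diff_right)
    have "(norm (lam k *\<^sub>R ?u - (?u - ?v)))\<^sup>2 + (1 - \<epsilon>) * (norm (?u - ?v))\<^sup>2 \<le> (norm (lam k *\<^sub>R ?u))\<^sup>2"
    proof -
      have "T (z k) - T (z (Suc k)) = lam k *\<^sub>R ?u - (?u - ?v)" unfolding zu by simp
      moreover have "norm ((T (z k) - z k) - (T (z (Suc k)) - z (Suc k))) = norm (?u - ?v)"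
        using norm_minus_cancel[of "?u - ?v"] by (simp add: algebra_simps)
      ultimately show ?thesis
        using estimate[of "z k" "z (Suc k)"] g_nonneg[of "z k" "z (Suc k)"] zu by (simp only:)
    qed
    then have "norm ?v \<le> norm ?u"
      using lam_pos[of k] lam_less[of k] by (intro relaxed_averaged_residual_le) auto
    then show "norm (T (z (Suc k)) - z (Suc k)) \<le> norm (T (z k) - z k)"
      by (simp only: norm_minus_commute)
  qed
  have dec_a: "decseq a"
    unfolding a_def[abs_def] decseq_def
    using decseqD[OF dec_res] by (auto intro: power_mono)
  obtain z\<^sub>1 where z1: "z\<^sub>1 \<in> Fix T" using Fix_T by blast
  have "a \<longlonglongrightarrow> 0"
    using decseq_null_if_weighted_sum_bounded[OF dec_a a_nonneg less_imp_le[OF \<tau>_pos] \<tau>_sum sum_\<tau>[OF z1]] .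
  then have res: "(\<lambda>k. norm (T (z k) - z k)) \<longlonglongrightarrow> 0"
    using tendsto_real_sqrt[of a 0 sequentially] by (simp add: a_def)
  obtain zw where zw: "zw \<in> Fix T" "weakly_converges z zw"
    using fejer_weakly_converges[OF fejer Fix_T nonexp res] by blast

  \<comment> \<open>Weak limits of the resolvent sequences\<close>
  have g_null: "(\<lambda>k. g (z k) zs) \<longlonglongrightarrow> 0" if "zs \<in> Fix T" for zs
  proof (rule tendsto_sandwich[OF _ _ tendsto_const])
    \<comment> \<open>The estimate bounds \<open>g\<close> by a difference of squares, whose first
      factor is at most the residual and whose second is bounded by Fejer monotonicity.\<close>
    have "g (z k) zs \<le> norm (T (z k) - z k) * (2 * norm (z 0 - zs))" for k
    proof -
      let ?s = "norm (z k - zs)" and ?t = "norm (T (z k) - zs)"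
      have Tzs: "T zs = zs" using that by (simp add: Fix_def)
      have "0 \<le> (1 - \<epsilon>) * (norm ((T (z k) - z k) - (T zs - zs)))\<^sup>2" using \<epsilon>(2) by simp
      then have "g (z k) zs \<le> ?s\<^sup>2 - ?t\<^sup>2" using estimate[of "z k" zs] unfolding Tzs by linarith
      also have "\<dots> = (?s - ?t) * (?s + ?t)" by (simp add: power2_eq_square algebra_simps)
      also have "\<dots> \<le> norm (T (z k) - z k) * (2 * norm (z 0 - zs))"
      proof (rule mult_mono)
        show "?s - ?t \<le> norm (T (z k) - z k)"
          using norm_triangle_ineq2[of "z k - zs" "T (z k) - zs"] by (simp add: norm_minus_commute)
        show "?s + ?t \<le> 2 * norm (z 0 - zs)"
          using z_bound[OF that, of k] nonexp[of "z k" zs] unfolding Tzs by linarith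
      qed simp_all
      finally show ?thesis .
    qed
    then show "eventually (\<lambda>k. g (z k) zs \<le> norm (T (z k) - z k) * (2 * norm (z 0 - zs))) sequentially"
      by (rule always_eventually[OF allI])
    show "(\<lambda>k. norm (T (z k) - z k) * (2 * norm (z 0 - zs))) \<longlonglongrightarrow> 0"
      using tendsto_mult_left_zero[OF res] .
  qed (simp add: g_nonneg)
  have le_g: "\<kappa> * (norm (C (JB w) - C (JB v)))\<^sup>2 \<le> g w v" "MA w v \<le> g w v" "MB w v \<le> g w v" for w v
  proof -
    have "0 \<le> \<kappa> * (norm (C (JB w) - C (JB v)))\<^sup>2" using \<kappa> by simp
    then show "\<kappa> * (norm (C (JB w) - C (JB v)))\<^sup>2 \<le> g w v" "MA w v \<le> g w v" "MB w v \<le> g w v"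
      unfolding g_def using MA_nonneg[of w v] MB_nonneg[of w v] by linarith+
  qed
  have null_if_le_g: "h \<longlonglongrightarrow> 0" if "zs \<in> Fix T" "\<And>k. 0 \<le> h k" "\<And>k. h k \<le> g (z k) zs"
    for zs and h :: "nat \<Rightarrow> real"
    by (rule tendsto_sandwich[OF _ _ tendsto_const g_null[OF that(1)]]) (use that(2,3) in simp_all)
  have C_lim: "(\<lambda>k. C (JB (z k))) \<longlonglongrightarrow> C (JB zs)" if "zs \<in> Fix T" for zs
  proof -
    have "(\<lambda>k. \<kappa> * (norm (C (JB (z k)) - C (JB zs)))\<^sup>2) \<longlonglongrightarrow> 0"
      by (rule null_if_le_g[OF that]) (use le_g(1) \<kappa> in simp_all)
    then have "(\<lambda>k. \<kappa> * (norm (C (JB (z k)) - C (JB zs)))\<^sup>2 / \<kappa>) \<longlonglongrightarrow> 0"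
      by (rule tendsto_divide_zero)
    then have "(\<lambda>k. (norm (C (JB (z k)) - C (JB zs)))\<^sup>2) \<longlonglongrightarrow> 0" using \<kappa> by simp
    then have "(\<lambda>k. norm (C (JB (z k)) - C (JB zs))) \<longlonglongrightarrow> 0"
      using tendsto_real_sqrt[of "\<lambda>k. (norm (C (JB (z k)) - C (JB zs)))\<^sup>2" 0 sequentially] by simp
    then show ?thesis by (simp only: tendsto_norm_zero_iff LIM_zero_iff)
  qed
  have xA_Fix: "xA zs = JB zs" if "zs \<in> Fix T" for zs
    using that T_diff[of zs] by (simp add: Fix_def)
  have JB_Z: "JB zs \<in> Z" if "zs \<in> Fix T" for zs
  proof -
    have "pA zs /\<^sub>R \<gamma> \<in> A (JB zs)" "pB zs /\<^sub>R \<gamma> \<in> B (JB zs)"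
      using pA_mem[of zs] pB_mem[of zs] \<gamma>(1) by (simp_all add: scale_op_mem_iff xA_Fix[OF that])
    \<comment> \<open>At a fixed point the two resolvent values coincide, so all terms except those
      with C cancel.\<close>
    moreover have "pA zs + pB zs + \<gamma> *\<^sub>R C (JB zs) = 0"
      by (simp add: pA_def pB_def q_def xA_Fix[OF that] scaleR_2)
    then have "(pA zs + pB zs + \<gamma> *\<^sub>R C (JB zs)) /\<^sub>R \<gamma> = 0" by simp
    then have "0 = pA zs /\<^sub>R \<gamma> + pB zs /\<^sub>R \<gamma> + C (JB zs)"
      using \<gamma>(1) by (simp add: scaleR_add_right)
    ultimately show ?thesis unfolding Z zer_def plus_op_def single_op_def by blast
  qed
  have C_Z: "C xs = C (JB zs)" if "xs \<in> Z" "zs \<in> Fix T" for xs zs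
    using cocoercive_zer_sum_unique[OF mono_A mono_B C \<beta>] that(1) JB_Z[OF that(2)] unfolding Z by blast
  \<comment> \<open>This difference is the residual \<open>T (z k) - z k\<close>.\<close>
  have xA_JB: "(\<lambda>k. xA (z k) - JB (z k)) \<longlonglongrightarrow> 0"
    using res by (simp only: tendsto_norm_zero_iff T_diff)
  have bounded_z: "bounded (range z)"
  proof (rule boundedI)
    fix x assume "x \<in> range z"
    then obtain k where "x = z k" by blast
    then show "norm x \<le> norm z\<^sub>1 + norm (z 0 - z\<^sub>1)"
      using norm_triangle_sub[of "z k" z\<^sub>1] z_bound[OF z1, of k] by simp
  qed
  have bounded_JB: "bounded (range (\<lambda>k. JB (z k)))"
  proof (rule boundedI)
    fix x assume "x \<in> range (\<lambda>k. JB (z k))"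
    then obtain k where "x = JB (z k)" by blast
    then show "norm x \<le> norm (JB z\<^sub>1) + norm (z 0 - z\<^sub>1)"
      using norm_triangle_sub[of "JB (z k)" "JB z\<^sub>1"] JB_nonexp[of "z k" z\<^sub>1] z_bound[OF z1, of k] by simp
  qed
  have bounded_xA: "bounded (range (\<lambda>k. xA (z k)))"
  proof (rule boundedI)
    fix x assume "x \<in> range (\<lambda>k. xA (z k))"
    then obtain k where k: "x = xA (z k)" by blast
    have "norm (xA (z k) - JB (z k)) \<le> norm (T (z 0) - z 0)"
      using decseqD[OF dec_res, of 0 k] by (simp add: T_diff)
    moreover have "norm (JB (z k)) \<le> norm (JB z\<^sub>1) + norm (z 0 - z\<^sub>1)"
      using norm_triangle_sub[of "JB (z k)" "JB z\<^sub>1"] JB_nonexp[of "z k" z\<^sub>1] z_bound[OF z1, of k] by linarith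
    ultimately show "norm x \<le> norm (T (z 0) - z 0) + (norm (JB z\<^sub>1) + norm (z 0 - z\<^sub>1))"
      using norm_triangle_sub[of "xA (z k)" "JB (z k)"] k by simp
  qed
  have weak_JB: "weakly_converges (\<lambda>k. JB (z k)) (JB zw)"
  proof (rule splitting_weakly_converges[OF A' mono_B' _ _ xA_JB _ zw(2) bounded_z bounded_JB])
    show "z k - JB (z k) \<in> scale_op \<gamma> B (JB (z k))" for k using pB_mem[of "z k"] by (simp add: pB_def)
    show "pA (z k) \<in> scale_op \<gamma> A (xA (z k))" for k by (rule pA_mem)
    have "(\<lambda>k. - (xA (z k) - JB (z k)) - \<gamma> *\<^sub>R C (JB (z k))) \<longlonglongrightarrow> - 0 - \<gamma> *\<^sub>R C (JB zw)"
      by (rule tendsto_diff[OF tendsto_minus[OF xA_JB] tendsto_scaleR[OF tendsto_const C_lim[OF zw(1)]]])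
    moreover have "pA (z k) - (JB (z k) - z k) = - (xA (z k) - JB (z k)) - \<gamma> *\<^sub>R C (JB (z k))" for k
      by (simp add: pA_def q_def scaleR_2)
    ultimately show "(\<lambda>k. pA (z k) - (JB (z k) - z k)) \<longlonglongrightarrow> - (\<gamma> *\<^sub>R C (JB zw))" by simp
    show "zw - JB zw \<in> scale_op \<gamma> B (JB zw)" using pB_mem[of zw] by (simp add: pB_def)
    have "pA zw = JB zw - zw - \<gamma> *\<^sub>R C (JB zw)" by (simp add: pA_def q_def scaleR_2 xA_Fix[OF zw(1)])
    then show "JB zw - zw - \<gamma> *\<^sub>R C (JB zw) \<in> scale_op \<gamma> A (JB zw)"
      using pA_mem[of zw] by (simp add: xA_Fix[OF zw(1)])
  qed
  have weak_xA: "weakly_converges (\<lambda>k. xA (z k)) (JB zw)"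
    by (rule weakly_converges_diff_null[OF weak_JB xA_JB])
  \<comment> \<open>Identifies an arbitrary weak limit with \<open>zw\<close>, which is known to be
    a fixed point.\<close>
  have weak_lim: "zs = zw" if "weakly_converges z zs" for zs
    by (rule weakly_converges_unique[OF that zw(2)])

  \<comment> \<open>Summability, rates and strong convergence\<close>
  have part4: "summable (\<lambda>i. lam i * (norm (C (JB (z i)) - C xs))\<^sup>2)
      \<and> (\<Sum>i. lam i * (norm (C (JB (z i)) - C xs))\<^sup>2)
          \<le> 1 / (\<gamma> * (2 * \<beta> - \<gamma> / \<epsilon>)) * (norm (z 0 - zs))\<^sup>2
      \<and> (\<lambda>j. C (JB (z j))) \<longlonglongrightarrow> C xs" if "xs \<in> Z" "zs \<in> Fix T" for xs zs
  proof -
    \<comment> \<open>The sum is estimated with \<open>JB zs\<close> in place of \<open>xs\<close>;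
      \<open>C_Z\<close> says that C takes the same value at both.\<close>
    define f where "f i = lam i * (norm (C (JB (z i)) - C (JB zs)))\<^sup>2" for i
    have f_nonneg: "0 \<le> f i" for i using less_imp_le[OF lam_pos[of i]] by (simp add: f_def)
    have f_sum: "(\<Sum>i<n. f i) \<le> 1 / \<kappa> * (norm (z 0 - zs))\<^sup>2" for n
    proof -
      have "\<kappa> * f i \<le> lam i * g (z i) zs" for i
        using mult_left_mono[OF le_g(1)[of "z i" zs] less_imp_le[OF lam_pos[of i]]]
        by (simp add: f_def mult.left_commute)
      then have "(\<Sum>i<n. \<kappa> * f i) \<le> (\<Sum>i<n. lam i * g (z i) zs)" by (rule sum_mono)
      then have "\<kappa> * (\<Sum>i<n. f i) \<le> (norm (z 0 - zs))\<^sup>2"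
        using sum_lam[OF that(2), of n] by (simp add: sum_distrib_left)
      then show ?thesis using \<kappa> by (simp add: field_simps)
    qed
    have "summable f" by (rule summableI_nonneg_bounded[OF f_nonneg f_sum])
    moreover have "suminf f \<le> 1 / \<kappa> * (norm (z 0 - zs))\<^sup>2"
      by (rule suminf_le_const[OF \<open>summable f\<close> f_sum])
    ultimately show ?thesis
      using C_lim[OF that(2)] unfolding C_Z[OF that] \<kappa>_def f_def[abs_def] by blast
  qed
  have part7: "(\<forall>zs\<in>Fix T. \<forall>k. (norm (T (z k) - z k))\<^sup>2
            \<le> (norm (z 0 - zs))\<^sup>2 / ((INF j. \<tau> j) * (real k + 1)))
        \<and> (\<lambda>k. (norm (T (z k) - z k))\<^sup>2) \<in> o(\<lambda>k. 1 / (real k + 1))" if "(INF j. \<tau> j) > 0"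
  proof -
    define t where "t = (INF j. \<tau> j)"
    have t: "t > 0" using that by (simp add: t_def)
    have t_le: "t \<le> \<tau> j" for j
      unfolding t_def by (rule cINF_lower) (auto intro!: bdd_belowI[of _ 0] less_imp_le[OF \<tau>_pos])
    have t_sum: "t * (\<Sum>i<n. a i) \<le> (norm (z 0 - zs))\<^sup>2" if "zs \<in> Fix T" for n zs
    proof -
      have "(\<Sum>i<n. t * a i) \<le> (\<Sum>i<n. \<tau> i * a i)"
        by (intro sum_mono mult_right_mono t_le a_nonneg)
      then show ?thesis using sum_\<tau>[OF that, of n] by (simp add: sum_distrib_left)
    qed
    have "a k \<le> (norm (z 0 - zs))\<^sup>2 / (t * (real k + 1))" if "zs \<in> Fix T" for zs k
    proof -
      \<comment> \<open>All k + 1 residuals up to index \<open>k\<close> are at least the last one,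
        whence the factor k + 1.\<close>
      have "(\<Sum>i<Suc k. a k) \<le> (\<Sum>i<Suc k. a i)"
        by (intro sum_mono decseqD[OF dec_a]) simp
      then have "t * ((real k + 1) * a k) \<le> t * (\<Sum>i<Suc k. a i)"
        using t by (intro mult_left_mono) (simp_all add: algebra_simps)
      also note t_sum[OF that, of "Suc k"]
      finally have "a k * (t * (real k + 1)) \<le> (norm (z 0 - zs))\<^sup>2" by (simp only: mult_ac)
      moreover have "0 < t * (real k + 1)" using t by simp
      ultimately show ?thesis by (simp only: pos_le_divide_eq)
    qed
    moreover have "a \<in> o(\<lambda>k. 1 / (real k + 1))"
    proof (rule decseq_summable_smallo[OF dec_a a_nonneg])
      have "(\<Sum>i<n. a i) \<le> (norm (z 0 - z\<^sub>1))\<^sup>2 / t" for n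
        using t_sum[OF z1, of n] t by (simp add: pos_le_divide_eq mult.commute)
      then show "summable a" by (rule summableI_nonneg_bounded[OF a_nonneg])
    qed
    ultimately show ?thesis unfolding a_def[abs_def] t_def by blast
  qed
  have part8: "\<exists>x\<in>Z. (\<lambda>j. JB (z j)) \<longlonglongrightarrow> x \<and> (\<lambda>j. xA (z j)) \<longlonglongrightarrow> x"
    if "(\<forall>S. S \<noteq> {} \<and> bounded S \<and> S \<subseteq> dom_op A \<longrightarrow> uniformly_monotone_on S A)
      \<or> (\<forall>S. S \<noteq> {} \<and> bounded S \<and> S \<subseteq> dom_op B \<longrightarrow> uniformly_monotone_on S B)
      \<or> (\<forall>x\<in>Z. demiregular_at C x)"
  proof -
    have A_mem: "pA w /\<^sub>R \<gamma> \<in> A (xA w)" and B_mem: "pB w /\<^sub>R \<gamma> \<in> B (JB w)" for w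
      using pA_mem[of w] pB_mem[of w] \<gamma>(1) by (simp_all add: scale_op_mem_iff)
    \<comment> \<open>One strong limit suffices, since the two sequences differ by a null
      sequence.\<close>
    have "(\<lambda>j. JB (z j)) \<longlonglongrightarrow> JB zw \<or> (\<lambda>j. xA (z j)) \<longlonglongrightarrow> JB zw"
      using that
    proof (elim disjE)
      assume *: "\<forall>S. S \<noteq> {} \<and> bounded S \<and> S \<subseteq> dom_op A \<longrightarrow> uniformly_monotone_on S A"
      have "(\<lambda>j. xA (z j)) \<longlonglongrightarrow> xA zw"
      proof (rule uniformly_monotone_tendsto[where u="\<lambda>j. pA (z j) /\<^sub>R \<gamma>" and us="pA zw /\<^sub>R \<gamma>"])
        show "pA (z j) /\<^sub>R \<gamma> \<in> A (xA (z j))" "pA zw /\<^sub>R \<gamma> \<in> A (xA zw)" for j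
          by (rule A_mem)+
        \<comment> \<open>The sequence together with its expected limit is the bounded set on which
          uniform monotonicity is invoked.\<close>
        have "insert (xA zw) (range (\<lambda>j. xA (z j))) \<subseteq> dom_op A"
          using A_mem unfolding dom_op_def by blast
        then show "uniformly_monotone_on (insert (xA zw) (range (\<lambda>j. xA (z j)))) A"
          using * bounded_xA by simp
        have "(\<lambda>j. MA (z j) zw) \<longlonglongrightarrow> 0"
          by (rule null_if_le_g[OF zw(1) MA_nonneg le_g(2)])
        \<comment> \<open>\<open>MA\<close> is formed with elements of \<gamma> A; dividing by
          \<gamma> passes to A itself.\<close>
        then have "(\<lambda>j. MA (z j) zw / \<gamma>) \<longlonglongrightarrow> 0" by (rule tendsto_divide_zero)
        then show "(\<lambda>j. (xA (z j) - xA zw) \<bullet> (pA (z j) /\<^sub>R \<gamma> - pA zw /\<^sub>R \<gamma>)) \<longlonglongrightarrow> 0"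
          by (simp add: MA_def divide_inverse mult.commute flip: scaleR_diff_right)
      qed
      then show ?thesis by (simp add: xA_Fix[OF zw(1)])
    next
      assume *: "\<forall>S. S \<noteq> {} \<and> bounded S \<and> S \<subseteq> dom_op B \<longrightarrow> uniformly_monotone_on S B"
      have "(\<lambda>j. JB (z j)) \<longlonglongrightarrow> JB zw"
      proof (rule uniformly_monotone_tendsto[where u="\<lambda>j. pB (z j) /\<^sub>R \<gamma>" and us="pB zw /\<^sub>R \<gamma>"])
        show "pB (z j) /\<^sub>R \<gamma> \<in> B (JB (z j))" "pB zw /\<^sub>R \<gamma> \<in> B (JB zw)" for j
          by (rule B_mem)+
        have "insert (JB zw) (range (\<lambda>j. JB (z j))) \<subseteq> dom_op B"
          using B_mem unfolding dom_op_def by blast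
        then show "uniformly_monotone_on (insert (JB zw) (range (\<lambda>j. JB (z j)))) B"
          using * bounded_JB by simp
        have "(\<lambda>j. MB (z j) zw) \<longlonglongrightarrow> 0"
          by (rule null_if_le_g[OF zw(1) MB_nonneg le_g(3)])
        then have "(\<lambda>j. MB (z j) zw / \<gamma>) \<longlonglongrightarrow> 0" by (rule tendsto_divide_zero)
        then show "(\<lambda>j. (JB (z j) - JB zw) \<bullet> (pB (z j) /\<^sub>R \<gamma> - pB zw /\<^sub>R \<gamma>)) \<longlonglongrightarrow> 0"
          by (simp add: MB_def divide_inverse mult.commute flip: scaleR_diff_right)
      qed
      then show ?thesis ..
    next
      assume "\<forall>x\<in>Z. demiregular_at C x"
      then have "demiregular_at C (JB zw)" using JB_Z[OF zw(1)] by blast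
      then show ?thesis
        using weak_JB C_lim[OF zw(1)] unfolding demiregular_at_def by blast
    qed
    then have "(\<lambda>j. JB (z j)) \<longlonglongrightarrow> JB zw \<and> (\<lambda>j. xA (z j)) \<longlonglongrightarrow> JB zw"
    proof
      assume "(\<lambda>j. JB (z j)) \<longlonglongrightarrow> JB zw"
      then show ?thesis using tendsto_add[OF xA_JB \<open>(\<lambda>j. JB (z j)) \<longlonglongrightarrow> JB zw\<close>] by simp
    next
      assume "(\<lambda>j. xA (z j)) \<longlonglongrightarrow> JB zw"
      then show ?thesis using tendsto_diff[OF \<open>(\<lambda>j. xA (z j)) \<longlonglongrightarrow> JB zw\<close> xA_JB] by simp
    qed
    then show ?thesis using JB_Z[OF zw(1)] by blast
  qed
  have part5: "weakly_converges (\<lambda>j. JB (z j)) (JB zs) \<and> JB zs \<in> Z"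
    and part6: "weakly_converges (\<lambda>j. xA (z j)) (JB zs) \<and> JB zs \<in> Z" if "weakly_converges z zs" for zs
    using weak_JB weak_xA JB_Z[OF zw(1)] by (simp_all add: weak_lim[OF that])
  show ?thesis
  proof (intro conjI)
    show "\<forall>zs\<in>Fix T. decseq (\<lambda>j. norm (z j - zs))" using fejer by (rule ballI)
    show "\<exists>zs\<in>Fix T. weakly_converges z zs" using zw(2) zw(1) by (rule bexI)
  qed (intro ballI allI impI dec_res res part4 part5 part6 part7 part8; assumption)+
qed

end
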